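(* Let $X$ be a Banach space and $f_k:X\to\mathbb{R}\cup\{+\infty\}$ $(k\in\mathbb{N}\cup\{0\})$ proper convex functions such that $C:=\operatorname{dom}f_0\cap\{x: f_k(x)\le0\ \forall k\in\mathbb{N}\}\neq\emptyset$. Let $\bar x\in X$ be a solution of problem (P): minimize $f_0(x)$ subject to $f_k(x)\le0$ $(k\in\mathbb{N})$. Suppose the Slater condition holds (there exists $x\in\operatorname{dom}f_0$ with $\sup_{k\in\mathbb{N}}f_k(x)<0$), and there exist $m\in\mathbb{N}\cup\{0\}$ and a solution $\lambda=(\lambda_1,\lambda_2,\ldots)\in\ell^\infty_+$ of problem (D$_m$) such that (i) the functions $f_0$, $\lambda_kf_k$ $(k=1,\ldots,m)$, $\lambda_kf_k^+$ $(k=m+1,m+2,\ldots)$ are lower semicontinuous on a neighbourhood of $\bar x$; (ii) the collection $\{f_0,\ \lambda_kf_k\ (k=1,\ldots,m),\ \lambda_kf_k^+\ (k=m+1,m+2,\ldots)\}$ is uniformly lower semicontinuous on a neighbourhood of $\bar x$. Then $\lambda_kf_k(\bar x)=0$ for $k=1,\ldots,m$, and for any $\varepsilon>0$ and $M>m$ there exist $n\in\mathbb{N}$ with $n>M$ and points $x_k\in B_\varepsilon(\bar x)$ $(k=0,\ldots,n)$ such that $$f_0(x_0)+\sum_{k=1}^m\lambda_kf_k(x_k)+\sum_{k=m+1}^n\lambda_kf_k^+(x_k)\le f_0(\bar x),$$ $$0\in\partial f_0(x_0)+\sum_{k=1}^m\lambda_k\partial f_k(x_k)+\sum_{k=m+1}^n\lambda_k\partial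 f_k^+(x_k)+\varepsilon\mathbb{B}^*,$$ with the convention $\lambda_k\partial f_k(x_k)=\lambda_k\partial f_k^+(x_k)=N_{\operatorname{dom}f_k}(x_k)$ when $\lambda_k=0$ $(k\in\mathbb{N})$.
   Context: Conventions: $0\cdot(+\infty)=+\infty$, $(+\infty)-(+\infty)=+\infty$. $f_k^+:=\max\{f_k,0\}$. $\ell^\infty_+$ is the set of nonnegative sequences in $\ell^\infty$. (D$_m$) is the problem $\sup_{\lambda\in\ell^\infty_+}\inf_{x\in X}\big(f_0(x)+\sum_{k=1}^m\lambda_kf_k(x)+\sum_{k=m+1}^\infty\lambda_kf_k^+(x)\big)$ (first sum zero if $m=0$); a solution attains the supremum. $B_\varepsilon(\bar x)$ is the open ball, $\mathbb{B}^*$ the open unit ball of $X^*$, $\partial$ the Fenchel subdifferential $\partial f(x)=\{x^*: f(y)-f(x)\ge\langle x^*,y-x\rangle\ \forall y\}$, $N_A(x)$ the normal cone of convex analysis. Uniform lower semicontinuity: for a nonempty index set $T$ and functions $g_t$ (here the listed collection), let $\mathcal{F}(T)$ be the finite subsets of $T$ directed by inclusion, $\limsup_{S\uparrow T}\alpha_S:=\inf_{S_0}\sup_{S\supset S_0}\alpha_S$, $\liminf_{S\uparrow T}\alpha_S:=\sup_{S_0}\inf_{S\supset S_0}\alpha_S$ over $S,S_0\in\mathcal{F}(T)$; $\big(\overline{\sum_{t\in T}}g_t\big)(x):=\limsup_{S\uparrow T}\sum_{t\in S}g_t(x)$; for $U\subset X$, $\Lambda_U(\{g_t\}):=\liminf_{S\uparrow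 T}\lim_{\delta\downarrow0}\inf\{\sum_{t\in S}g_t(x_t): x_t\in U,\ \operatorname{diam}\{x_t\}_{t\in S}<\delta\}$. The collection is uniformly lower semicontinuous on $U$ if $\inf_U\overline{\sum_{t\in T}}g_t\le\Lambda_U(\{g_t\})$. *)

theory Defs
  imports "HOL-Analysis.Analysis"
begin

text \<open>Extended-real conventions of the paper: 0 * (+inf) = +inf and (+inf) - (+inf) = +inf.\<close>

definition emul :: "real \<Rightarrow> ereal \<Rightarrow> ereal" where
  "emul c a = (if a = \<infinity> then \<infinity> else ereal c * a)"

definition esub :: "ereal \<Rightarrow> ereal \<Rightarrow> ereal" where
  "esub a b = (if a = \<infinity> \<and> b = \<infinity> then \<infinity> else a - b)"

definition epos :: "ereal \<Rightarrow> ereal" where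
  "epos a = max a 0"

definition edom :: "('a \<Rightarrow> ereal) \<Rightarrow> 'a set" where
  "edom f = {x. f x < \<infinity>}"

definition proper_convex :: "('a::real_vector \<Rightarrow> ereal) \<Rightarrow> bool" where
  "proper_convex f \<longleftrightarrow> (\<forall>x. f x \<noteq> -\<infinity>) \<and> (\<exists>x. f x \<noteq> \<infinity>) \<and>
     (\<forall>x y. \<forall>t\<in>{0<..<1}. f ((1 - t) *\<^sub>R x + t *\<^sub>R y) \<le> ereal (1 - t) * f x + ereal t * f y)"

definition lsc_at :: "'a::topological_space \<Rightarrow> ('a \<Rightarrow> ereal) \<Rightarrow> bool" where
  "lsc_at x f \<longleftrightarrow> (\<forall>y < f x. eventually (\<lambda>z. y < f z) (at x))"

definition fsubdiff :: "('a::real_normed_vector \<Rightarrow> ereal) \<Rightarrow> 'a \<Rightarrow> ('a \<Rightarrow>\<^sub>L real) set" where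
  "fsubdiff f x = {x'. \<forall>y. ereal (blinfun_apply x' (y - x)) \<le> esub (f y) (f x)}"

definition normal_cone :: "'a::real_normed_vector set \<Rightarrow> 'a \<Rightarrow> ('a \<Rightarrow>\<^sub>L real) set" where
  "normal_cone A x = (if x \<in> A then {x'. \<forall>y\<in>A. blinfun_apply x' (y - x) \<le> 0} else {})"

definition scaled_subdiff :: "real \<Rightarrow> ('a::real_normed_vector \<Rightarrow> ereal) \<Rightarrow> 'a \<Rightarrow> ('a \<Rightarrow>\<^sub>L real) set" where
  "scaled_subdiff c f x = (if c = 0 then normal_cone (edom f) x else (\<lambda>x'. c *\<^sub>R x') ` fsubdiff f x)"

text \<open>Nonnegative bounded sequences (ell-infinity plus); index 0 is not used.\<close>

definition linf_plus :: "(nat \<Rightarrow> real) \<Rightarrow> bool" where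
  "linf_plus l \<longleftrightarrow> (\<forall>k. 0 \<le> l k) \<and> bounded (range l)"

text \<open>Lagrangian of (D_m); f 0 is the objective, f k (k >= 1) the constraints.\<close>

definition lagr :: "(nat \<Rightarrow> 'a \<Rightarrow> ereal) \<Rightarrow> nat \<Rightarrow> (nat \<Rightarrow> real) \<Rightarrow> 'a \<Rightarrow> ereal" where
  "lagr f m l x = f 0 x + (\<Sum>k\<in>{1..m}. emul (l k) (f k x))
      + (\<Sum>k. if m < k then emul (l k) (epos (f k x)) else 0)"

definition dual_solution :: "(nat \<Rightarrow> 'a \<Rightarrow> ereal) \<Rightarrow> nat \<Rightarrow> (nat \<Rightarrow> real) \<Rightarrow> bool" where
  "dual_solution f m l \<longleftrightarrow> linf_plus l \<and>
     (\<forall>l'. linf_plus l' \<longrightarrow> (INF x. lagr f m l' x) \<le> (INF x. lagr f m l x))"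

text \<open>Uniform lower semicontinuity of a collection g indexed by nat, on a set U.
  Limits over finite subsets directed by inclusion; lim_{delta -> 0+} of the
  (monotone) infimum is written as its supremum over delta > 0.\<close>

definition limsup_fin :: "(nat set \<Rightarrow> ereal) \<Rightarrow> ereal" where
  "limsup_fin a = (INF S0\<in>{S. finite S}. SUP S\<in>{S. finite S \<and> S0 \<subseteq> S}. a S)"

definition liminf_fin :: "(nat set \<Rightarrow> ereal) \<Rightarrow> ereal" where
  "liminf_fin a = (SUP S0\<in>{S. finite S}. INF S\<in>{S. finite S \<and> S0 \<subseteq> S}. a S)"

definition upper_sum :: "(nat \<Rightarrow> 'a \<Rightarrow> ereal) \<Rightarrow> 'a \<Rightarrow> ereal" where
  "upper_sum g x = limsup_fin (\<lambda>S. \<Sum>t\<in>S. g t x)"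

definition Lambda_U :: "'a::metric_space set \<Rightarrow> (nat \<Rightarrow> 'a \<Rightarrow> ereal) \<Rightarrow> ereal" where
  "Lambda_U U g = liminf_fin (\<lambda>S. SUP \<delta>\<in>{0<..}.
      INF xs\<in>{xs. (\<forall>t\<in>S. xs t \<in> U) \<and> diameter (xs ` S) < \<delta>}. \<Sum>t\<in>S. g t (xs t))"

definition uniformly_lsc :: "'a::metric_space set \<Rightarrow> (nat \<Rightarrow> 'a \<Rightarrow> ereal) \<Rightarrow> bool" where
  "uniformly_lsc U g \<longleftrightarrow> (INF x\<in>U. upper_sum g x) \<le> Lambda_U U g"

definition coll :: "(nat \<Rightarrow> 'a \<Rightarrow> ereal) \<Rightarrow> nat \<Rightarrow> (nat \<Rightarrow> real) \<Rightarrow> nat \<Rightarrow> 'a \<Rightarrow> ereal" where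
  "coll f m l k x = (if k = 0 then f 0 x
      else if k \<le> m then emul (l k) (f k x) else emul (l k) (epos (f k x)))"

end

theory Submission
  imports Defs
begin

text \<open>
  The Slater condition gives strong duality, so the Lagrangian at the dual solution is bounded below
  by the optimal value v; evaluating it at the primal solution yields complementary slackness.
  Uniform lower semicontinuity then turns this into an approximate decoupled minimum: for large n,
  the sum of the first n terms evaluated at nearby but different points stays above v minus a small
  constant. Penalising the distances between the points and applying Ekeland's variational principle
  in the product space produces an exact minimum of the sum plus a finite convex coupling term.
  Hahn-Banach splits it into subgradients of the individual functions, and testing with diagonal
  directions, along which the penalty is constant, bounds the norm of their sum.
\<close>

section \<open>The Hahn-Banach theorem for convex functions\<close>

text \<open>Giving each function its own point moves all interaction into the coupling term, which
  is finite and Lipschitz in every coordinate; this is what the Hahn-Banach splitting requires. The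
  order of the constants matters: a radius r inside both neighbourhoods, the slope \<alpha> =
  \<epsilon>/2, a tolerance \<eta> < \<alpha> * r, and only then n and \<delta>, which uniform lower
  semicontinuity supplies for that tolerance. So n is unknown when \<alpha> is fixed, and the
  distance used in Ekeland's principle has to bound the sum of the subgradients independently of n.
  The inequality \<eta> < \<alpha> * r keeps the perturbed minimiser strictly inside the ball, where
  convexity turns a minimum over the ball into a global one. The penalty weight comes last, from
  \<delta> and from lower bounds on the ball, which exist because a convex function that is lower
  semicontinuous at one point of its domain is bounded below on every ball around it.\<close>

text \<open>Partial minimisation preserves convexity. The hypothesis \<open>joint\<close> lets the
  parameter \<open>r\<close> be chosen freely, which covers both infima over chains (the smaller of
  two members) and infimal convolutions (a convex combination of the parameters).\<close>

lemma convex_on_INF: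
  fixes \<Phi> :: "'p \<Rightarrow> 'a::real_vector \<Rightarrow> real"
  assumes ne: "A \<noteq> {}" and bdd: "\<And>x. bdd_below ((\<lambda>p. \<Phi> p x) ` A)"
    and joint: "\<And>p q x y t. p \<in> A \<Longrightarrow> q \<in> A \<Longrightarrow> 0 < t \<Longrightarrow> t < 1 \<Longrightarrow>
      \<exists>r\<in>A. \<Phi> r ((1 - t) *\<^sub>R x + t *\<^sub>R y) \<le> (1 - t) * \<Phi> p x + t * \<Phi> q y"
  shows "convex_on UNIV (\<lambda>x. INF p\<in>A. \<Phi> p x)"
proof (rule convex_onI)
  fix t :: real and x y :: 'a
  assume t: "0 < t" "t < 1"
  let ?I = "\<lambda>x. INF p\<in>A. \<Phi> p x"
  show "?I ((1 - t) *\<^sub>R x + t *\<^sub>R y) \<le> (1 - t) * ?I x + t * ?I y"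
  proof (rule field_le_epsilon)
    fix e :: real assume e: "0 < e"
    have "\<exists>p\<in>A. \<Phi> p z < ?I z + e" for z
    proof (rule ccontr)
      assume "\<not> ?thesis"
      then have "?I z + e \<le> ?I z"
        using ne by (intro cINF_greatest) (auto simp: not_less)
      then show False using e by simp
    qed
    then obtain p q where p: "p \<in> A" "\<Phi> p x < ?I x + e" and q: "q \<in> A" "\<Phi> q y < ?I y + e"
      by metis
    obtain r where r: "r \<in> A"
      "\<Phi> r ((1 - t) *\<^sub>R x + t *\<^sub>R y) \<le> (1 - t) * \<Phi> p x + t * \<Phi> q y"
      using joint[OF p(1) q(1) t] by blast
    have "?I ((1 - t) *\<^sub>R x + t *\<^sub>R y) \<le> \<Phi> r ((1 - t) *\<^sub>R x + t *\<^sub>R y)"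
      by (rule cINF_lower[OF bdd r(1)])
    also have "\<dots> \<le> (1 - t) * \<Phi> p x + t * \<Phi> q y" by (rule r(2))
    also have "\<dots> \<le> (1 - t) * (?I x + e) + t * (?I y + e)"
      using t p(2) q(2) by (intro add_mono mult_left_mono) auto
    finally show "?I ((1 - t) *\<^sub>R x + t *\<^sub>R y) \<le> (1 - t) * ?I x + t * ?I y + e"
      by (simp add: algebra_simps)
  qed
qed simp

text \<open>0 is the midpoint of \<open>h\<close> and \<open>- h\<close>. Applied to a minorant of a
  fixed function, this bounds the minorant from below pointwise, so infima over chains of minorants
  stay finite.\<close>

lemma convex_on_zero_lower:
  fixes q :: "'a::real_vector \<Rightarrow> real"
  assumes "convex_on UNIV q" "q 0 = 0"
  shows "- q (- h) \<le> q h"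
  using convex_onD[OF assms(1), of "1/2" "-h" h] assms(2) by simp

text \<open>A minimal convex function vanishing at 0 is linear, so no extension from subspaces is needed.\<close>

lemma hahn_banach_convex:
  fixes q :: "'a::real_vector \<Rightarrow> real"
  assumes q: "convex_on UNIV q" and q0: "q 0 = 0"
  shows "\<exists>y. linear y \<and> (\<forall>h. y h \<le> q h)"
proof -
  define A where "A = {r. convex_on UNIV r \<and> r 0 = 0 \<and> r \<le> q}"
  have qA: "q \<in> A" using q q0 by (simp add: A_def)
  have "\<exists>m\<in>A. \<forall>r\<in>A. r \<le> m \<longrightarrow> r = m"
  proof (rule predicate_Zorn[where P = "\<lambda>a b. b \<le> a"])
    show "partial_order_on A (relation_of (\<lambda>a b. b \<le> a) A)"
      by (auto simp: partial_order_on_def preorder_on_def refl_on_def trans_def antisym_def relation_of_def)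
  next
    fix C assume "C \<in> Chains (relation_of (\<lambda>a b. b \<le> a) A)"
    then have CA: "C \<subseteq> A" and chain: "\<And>r s. r \<in> C \<Longrightarrow> s \<in> C \<Longrightarrow> r \<le> s \<or> s \<le> r"
      by (auto simp: Chains_def relation_of_def)
    show "\<exists>u\<in>A. \<forall>a\<in>C. u \<le> a"
    proof (cases "C = {}")
      case True
      then show ?thesis using qA by blast
    next
      case False
      define u where "u = (\<lambda>x. INF r\<in>C. r x)"
      have bdd: "bdd_below ((\<lambda>r. r x) ` C)" for x
      proof (rule bdd_belowI2)
        fix r assume "r \<in> C"
        then have "convex_on UNIV r" "r 0 = 0" "r (- x) \<le> q (- x)"
          using CA by (auto simp: A_def le_fun_def)
        then show "- q (- x) \<le> r x" using convex_on_zero_lower[of r x] by linarith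
      qed
      have "convex_on UNIV u" unfolding u_def
      proof (rule convex_on_INF[OF False bdd])
        fix r s x y and t :: real assume "r \<in> C" "s \<in> C" and t: "0 < t" "t < 1"
        then obtain p where p: "p \<in> C" "p \<le> r" "p \<le> s" using chain[of r s] by blast
        then have "convex_on UNIV p" using CA by (auto simp: A_def)
        then have "p ((1 - t) *\<^sub>R x + t *\<^sub>R y) \<le> (1 - t) * p x + t * p y"
          using t by (intro convex_onD) auto
        also have "\<dots> \<le> (1 - t) * r x + t * s y"
          using t p by (intro add_mono mult_left_mono) (auto simp: le_fun_def)
        finally show "\<exists>p\<in>C. p ((1 - t) *\<^sub>R x + t *\<^sub>R y) \<le> (1 - t) * r x + t * s y"
          using p(1) by blast
      qed
      moreover have "u 0 = 0"
      proof -
        have "u 0 = (INF r\<in>C. 0)" unfolding u_def using CA by (intro INF_cong) (auto simp: A_def)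
        then show ?thesis using False by simp
      qed
      moreover have le: "u \<le> r" if "r \<in> C" for r
        unfolding u_def le_fun_def using cINF_lower[OF bdd that] by blast
      moreover have "u \<le> q"
      proof -
        obtain r where "r \<in> C" using False by blast
        then show ?thesis using le[of r] CA by (auto simp: A_def)
      qed
      ultimately show ?thesis unfolding A_def by blast
    qed
  qed
  then obtain m where m: "m \<in> A" and min: "\<And>r. r \<in> A \<Longrightarrow> r \<le> m \<Longrightarrow> r = m" by blast
  have mc: "convex_on UNIV m" and m0: "m 0 = 0" and mq: "m \<le> q" using m by (auto simp: A_def)
  have minimal: "r = m" if "convex_on UNIV r" "r 0 = 0" "r \<le> m" for r
    using min[of r] that mq by (auto simp: A_def)
  have hom1: "m (s *\<^sub>R x) = s * m x" if s: "0 < s" "s \<le> 1" for s x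
  proof -
    \<comment> \<open>By convexity and \<open>m 0 = 0\<close> this rescaling lies below
      \<open>m\<close>, and it is again convex and zero at 0, so minimality forces equality.\<close>
    define r where "r = (\<lambda>x. m (s *\<^sub>R x) / s)"
    have "convex_on UNIV r"
    proof (rule convex_onI)
      fix t :: real and x y assume t: "0 < t" "t < 1"
      have "m ((1 - t) *\<^sub>R (s *\<^sub>R x) + t *\<^sub>R (s *\<^sub>R y)) \<le> (1 - t) * m (s *\<^sub>R x) + t * m (s *\<^sub>R y)"
        using t by (intro convex_onD[OF mc]) auto
      moreover have "(1 - t) *\<^sub>R (s *\<^sub>R x) + t *\<^sub>R (s *\<^sub>R y) = s *\<^sub>R ((1 - t) *\<^sub>R x + t *\<^sub>R y)"
        by (simp add: algebra_simps)
      ultimately show "r ((1 - t) *\<^sub>R x + t *\<^sub>R y) \<le> (1 - t) * r x + t * r y"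
        using s by (simp add: r_def field_simps)
    qed simp
    moreover have "r 0 = 0" by (simp add: r_def m0)
    moreover have "r x \<le> m x" for x
      using convex_onD[OF mc, of s 0 x] s m0 by (simp add: r_def field_simps)
    ultimately have "r = m" by (intro minimal) (auto simp: le_fun_def)
    then have "m x = m (s *\<^sub>R x) / s" unfolding r_def by metis
    then show ?thesis using s by (simp add: field_simps)
  qed
  have hom: "m (s *\<^sub>R x) = s * m x" if s: "0 \<le> s" for s x
  proof -
    consider "s = 0" | "0 < s" "s \<le> 1" | "1 < s" using s by linarith
    then show ?thesis
    proof cases
      case 3
      have "m ((1/s) *\<^sub>R (s *\<^sub>R x)) = (1/s) * m (s *\<^sub>R x)" using 3 by (intro hom1) auto
      then show ?thesis using 3 by (simp add: field_simps)
    qed (auto simp: m0 hom1)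
  qed
  have sub: "m (x + y) \<le> m x + m y" for x y
  proof -
    have "m ((1 - 1/2) *\<^sub>R x + (1/2) *\<^sub>R y) \<le> (1 - 1/2) * m x + (1/2) * m y"
      by (intro convex_onD[OF mc]) auto
    moreover have "(1 - 1/2) *\<^sub>R x + (1/2) *\<^sub>R y = (1/2) *\<^sub>R (x + y)" by (simp add: algebra_simps)
    moreover have "m ((1/2) *\<^sub>R (x + y)) = (1/2) * m (x + y)" by (rule hom) simp
    ultimately show ?thesis by simp
  qed
  have add: "m (x + a) = m x + m a" for x a
  proof -
    \<comment> \<open>Removing the slope along \<open>a\<close> gives another convex minorant of
      \<open>m\<close> that vanishes at 0, by positive homogeneity. It therefore equals
      \<open>m\<close>, and its entry at t = 1 is the superadditivity that complements
      \<open>sub\<close>.\<close>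
    define r where "r = (\<lambda>x. INF t\<in>{0::real..}. m (x + t *\<^sub>R a) - t * m a)"
    have lower: "- m (- x) \<le> m (x + t *\<^sub>R a) - t * m a" if "0 \<le> t" for x t
      using sub[of "x + t *\<^sub>R a" "- x"] hom[OF that, of a] by simp
    have bdd: "bdd_below ((\<lambda>t. m (x + t *\<^sub>R a) - t * m a) ` {0..})" for x
      by (rule bdd_belowI2[of _ "- m (- x)"]) (use lower in auto)
    have "convex_on UNIV r" unfolding r_def
    proof (rule convex_on_INF[OF _ bdd])
      fix p q t :: real and x y assume p: "p \<in> {0..}" "q \<in> {0..}" and t: "0 < t" "t < 1"
      have eq: "(1 - t) *\<^sub>R x + t *\<^sub>R y + ((1 - t) * p + t * q) *\<^sub>R a
          = (1 - t) *\<^sub>R (x + p *\<^sub>R a) + t *\<^sub>R (y + q *\<^sub>R a)" by (simp add: algebra_simps)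
      have "m (\<dots>) \<le> (1 - t) * m (x + p *\<^sub>R a) + t * m (y + q *\<^sub>R a)"
        using t by (intro convex_onD[OF mc]) auto
      then have "m ((1 - t) *\<^sub>R x + t *\<^sub>R y + ((1 - t) * p + t * q) *\<^sub>R a) - ((1 - t) * p + t * q) * m a
        \<le> (1 - t) * (m (x + p *\<^sub>R a) - p * m a) + t * (m (y + q *\<^sub>R a) - q * m a)"
        unfolding eq by (simp add: algebra_simps)
      moreover have "(1 - t) * p + t * q \<in> {0..}" using p t by simp
      ultimately show "\<exists>r\<in>{0..}. m ((1 - t) *\<^sub>R x + t *\<^sub>R y + r *\<^sub>R a) - r * m a
        \<le> (1 - t) * (m (x + p *\<^sub>R a) - p * m a) + t * (m (y + q *\<^sub>R a) - q * m a)" by blast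
    qed auto
    moreover have "r 0 = 0"
    proof -
      have "(\<lambda>t. m (0 + t *\<^sub>R a) - t * m a) ` {0..} = {0}" by (auto simp: hom image_def)
      then show ?thesis by (simp add: r_def)
    qed
    moreover have "r x \<le> m x" for x
      unfolding r_def using cINF_lower[OF bdd, of 0 x] by simp
    ultimately have "r = m" by (intro minimal) (auto simp: le_fun_def)
    then have "m x \<le> m (x + a) - m a"
      using cINF_lower[OF bdd, of 1 x] by (simp add: r_def fun_eq_iff)
    then show ?thesis using sub[of x a] by linarith
  qed
  have "linear m"
  proof (rule linearI)
    fix s x
    show "m (s *\<^sub>R x) = s *\<^sub>R m x"
    proof (cases "0 \<le> s")
      case False
      have "m (s *\<^sub>R x) + m ((- s) *\<^sub>R x) = 0" using add[of "s *\<^sub>R x" "(- s) *\<^sub>R x"] m0 by simp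
      then show ?thesis using hom[of "- s" x] False by simp
    qed (simp add: hom)
  qed (rule add)
  then show ?thesis using mq by (auto simp: le_fun_def)
qed

section \<open>Ekeland's principle and convex multipliers\<close>

text \<open>The form is fitted to the application: \<open>d\<close> may vanish between distinct
  points, since tuples will be compared only in finitely many coordinates, and completeness and
  lower semicontinuity are merged into one hypothesis about Cauchy sequences along which \<phi>
  decreases. The set \<open>Z\<close> will consist of tuples in domains that need not be closed, and
  the decrease of \<phi> is what keeps limits inside.\<close>

lemma ekeland_principle:
  fixes \<phi> :: "'b \<Rightarrow> real" and d :: "'b \<Rightarrow> 'b \<Rightarrow> real"
  assumes d_refl: "\<And>x. d x x = 0" and d_sym: "\<And>x y. d x y = d y x"
    and d_tri: "\<And>x y z. d x z \<le> d x y + d y z"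
    and complete: "\<And>s. range s \<subseteq> Z \<Longrightarrow> (\<forall>e>0. \<exists>N. \<forall>i\<ge>N. \<forall>j\<ge>N. d (s i) (s j) < e) \<Longrightarrow>
      decseq (\<lambda>i. \<phi> (s i)) \<Longrightarrow> \<exists>z\<in>Z. (\<lambda>i. d (s i) z) \<longlonglongrightarrow> 0 \<and> (\<forall>i. \<phi> z \<le> \<phi> (s i))"
    and bound: "\<And>z. z \<in> Z \<Longrightarrow> b \<le> \<phi> z"
    and z0: "z0 \<in> Z" and \<alpha>: "0 < \<alpha>"
  shows "\<exists>z\<in>Z. \<phi> z + \<alpha> * d z0 z \<le> \<phi> z0 \<and> (\<forall>w\<in>Z. \<phi> z \<le> \<phi> w + \<alpha> * d z w)"
proof -
  have d_nonneg: "0 \<le> d x y" for x y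
    using d_tri[of x x y] d_refl[of x] d_sym[of x y] by linarith
  define S where "S z = {w\<in>Z. \<phi> w + \<alpha> * d z w \<le> \<phi> z}" for z
  \<comment> \<open>Improvement at rate \<alpha> is transitive by the triangle inequality, so the
    sets \<open>S (s n)\<close> along the sequence built below are nested.\<close>
  have S_trans: "u \<in> S z" if "w \<in> S z" "u \<in> S w" for u w z
  proof -
    have "\<alpha> * d z u \<le> \<alpha> * d z w + \<alpha> * d w u"
      using mult_left_mono[OF d_tri[of z u w], of \<alpha>] \<alpha> by (simp add: algebra_simps)
    then show ?thesis using that by (auto simp: S_def)
  qed
  have step: "\<exists>w\<in>S z. \<forall>u\<in>S z. \<phi> w \<le> \<phi> u + (1/2) ^ n" if "z \<in> Z" for z and n :: nat
  proof -
    have ne: "S z \<noteq> {}" using that by (auto simp: S_def d_refl)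
    have bdd: "bdd_below (\<phi> ` S z)" by (rule bdd_belowI2[of _ b]) (auto simp: S_def bound)
    have "\<exists>w\<in>S z. \<phi> w < (INF u\<in>S z. \<phi> u) + (1/2) ^ n"
    proof (rule ccontr)
      assume "\<not> ?thesis"
      then have "(INF u\<in>S z. \<phi> u) + (1/2) ^ n \<le> (INF u\<in>S z. \<phi> u)"
        by (intro cINF_greatest[OF ne]) (auto simp: not_less)
      moreover have "(0::real) < (1/2) ^ n" by simp
      ultimately show False by linarith
    qed
    then obtain w where w: "w \<in> S z" "\<phi> w < (INF u\<in>S z. \<phi> u) + (1/2) ^ n" by blast
    have "\<phi> w \<le> \<phi> u + (1/2) ^ n" if "u \<in> S z" for u
      using w(2) cINF_lower[OF bdd that] by linarith
    then show ?thesis using w(1) by blast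
  qed
  \<comment> \<open>Each successor is optimal on the current set up to \<open>(1/2) ^ n\<close>; the
    slack must tend to 0 for the final contradiction.\<close>
  define nxt where "nxt n z = (SOME w. w \<in> S z \<and> (\<forall>u\<in>S z. \<phi> w \<le> \<phi> u + (1/2) ^ n))" for n z
  have nxt: "nxt n z \<in> S z \<and> (\<forall>u\<in>S z. \<phi> (nxt n z) \<le> \<phi> u + (1/2) ^ n)" if "z \<in> Z" for n z
    unfolding nxt_def by (rule someI_ex) (use step[OF that, of n] in blast)
  define s where "s = rec_nat z0 nxt"
  have s0: "s 0 = z0" and sS: "s (Suc n) = nxt n (s n)" for n by (simp_all add: s_def)
  have sZ: "s n \<in> Z" for n
  proof (induction n)
    case (Suc n)
    then show ?case using nxt[of "s n" n] by (auto simp: sS S_def)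
  qed (simp add: s0 z0)
  have sin: "s j \<in> S (s i)" if "i \<le> j" for i j
    using that
  proof (induction rule: dec_induct)
    case base
    then show ?case using sZ by (simp add: S_def d_refl)
  next
    case (step j)
    then show ?case using S_trans[of "s j" "s i" "s (Suc j)"] nxt[OF sZ, of j j] by (simp add: sS)
  qed
  have gap: "\<alpha> * d (s i) (s j) \<le> \<phi> (s i) - \<phi> (s j)" if "i \<le> j" for i j
    using sin[OF that] by (simp add: S_def)
  have dec: "decseq (\<lambda>i. \<phi> (s i))"
  proof (rule decseq_SucI)
    fix i
    have "0 \<le> \<alpha> * d (s i) (s (Suc i))" using \<alpha> d_nonneg by simp
    then show "\<phi> (s (Suc i)) \<le> \<phi> (s i)" using gap[of i "Suc i"] by simp
  qed
  obtain v where v: "(\<lambda>i. \<phi> (s i)) \<longlonglongrightarrow> v"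
    using decseq_convergent[OF dec, of b] bound sZ by blast
  have "\<forall>e>0. \<exists>N. \<forall>i\<ge>N. \<forall>j\<ge>N. d (s i) (s j) < e"
  proof (intro allI impI)
    fix e :: real assume e: "0 < e"
    have "Cauchy (\<lambda>i. \<phi> (s i))" using v by (rule LIMSEQ_imp_Cauchy)
    then obtain N where N: "\<And>i j. i \<ge> N \<Longrightarrow> j \<ge> N \<Longrightarrow> \<bar>\<phi> (s i) - \<phi> (s j)\<bar> < \<alpha> * e"
      using \<alpha> e unfolding Cauchy_def dist_real_def by (meson mult_pos_pos)
    have *: "d (s i) (s j) < e" if "N \<le> i" "i \<le> j" for i j
    proof -
      have "\<alpha> * d (s i) (s j) < \<alpha> * e" using gap[OF that(2)] N[of i j] that by linarith
      then show ?thesis using \<alpha> by simp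
    qed
    show "\<exists>N. \<forall>i\<ge>N. \<forall>j\<ge>N. d (s i) (s j) < e"
      using * d_sym by (metis nle_le)
  qed
  then obtain z where z: "z \<in> Z" "(\<lambda>i. d (s i) z) \<longlonglongrightarrow> 0" "\<And>i. \<phi> z \<le> \<phi> (s i)"
    using complete[of s] sZ dec by blast
  have zS: "z \<in> S (s i)" for i
  proof -
    have "\<phi> z + \<alpha> * d (s i) z \<le> \<phi> (s i)"
    proof (rule LIMSEQ_le_const)
      show "(\<lambda>j. \<phi> (s i) + \<alpha> * d (s j) z) \<longlonglongrightarrow> \<phi> (s i)"
        using tendsto_add[OF tendsto_const[of "\<phi> (s i)"] tendsto_mult[OF tendsto_const[of \<alpha>] z(2)]] by simp
      show "\<exists>N. \<forall>j\<ge>N. \<phi> z + \<alpha> * d (s i) z \<le> \<phi> (s i) + \<alpha> * d (s j) z"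
      proof (intro exI allI impI)
        fix j assume "i \<le> j"
        have "\<alpha> * d (s i) z \<le> \<alpha> * d (s i) (s j) + \<alpha> * d (s j) z"
          using mult_left_mono[OF d_tri[of "s i" z "s j"], of \<alpha>] \<alpha> by (simp add: algebra_simps)
        then show "\<phi> z + \<alpha> * d (s i) z \<le> \<phi> (s i) + \<alpha> * d (s j) z"
          using gap[OF \<open>i \<le> j\<close>] z(3)[of j] by linarith
      qed
    qed
    then show ?thesis using z(1) by (simp add: S_def)
  qed
  have "\<phi> z \<le> \<phi> w + \<alpha> * d z w" if w: "w \<in> Z" for w
  proof (rule ccontr)
    \<comment> \<open>A violating \<open>w\<close> lies in \<open>S z\<close>, hence in every
      \<open>S (s n)\<close>, so each successor was nearly as good as \<open>w\<close>; in the limit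
      \<phi> z \<le> \<phi> w, against the assumed strict improvement.\<close>
    assume neg: "\<not> ?thesis"
    then have "w \<in> S z" using w by (simp add: S_def)
    then have "\<phi> (s (Suc n)) \<le> \<phi> w + (1/2) ^ n" for n
      using nxt[OF sZ, of n n] S_trans[OF zS] by (simp add: sS)
    then have "\<phi> z \<le> \<phi> w + (1/2) ^ n" for n using z(3)[of "Suc n"] order_trans by blast
    moreover have "(\<lambda>n. \<phi> w + (1/2) ^ n) \<longlonglongrightarrow> \<phi> w + 0"
      by (intro tendsto_intros LIMSEQ_power_zero) auto
    ultimately have "\<phi> z \<le> \<phi> w" using LIMSEQ_le_const by fastforce
    moreover have "0 \<le> \<alpha> * d z w" using \<alpha> d_nonneg by simp
    ultimately show False using neg by linarith
  qed
  then show ?thesis using zS[of 0] z(1) by (auto simp: s0 S_def)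
qed

section \<open>Lagrange multipliers under strict feasibility\<close>

text \<open>The multiplier is explicit: strictly feasible points \<open>y\<close> cap it by
  \<open>(F y - v) / (- g y)\<close>, infeasible points \<open>x\<close> require at least
  \<open>(v - F x) / g x\<close>, and convexity along the segment from \<open>x\<close> to
  \<open>y\<close> shows that no lower requirement exceeds a cap. The infimum of the caps therefore
  works.\<close>

lemma convex_multiplier:
  fixes F g :: "'a::real_vector \<Rightarrow> real"
  assumes F: "convex_on D F" and g: "convex_on D g"
    and y0: "y0 \<in> D" "g y0 < 0"
    and opt: "\<And>x. x \<in> D \<Longrightarrow> g x \<le> 0 \<Longrightarrow> v \<le> F x"
  shows "\<exists>\<mu>\<ge>0. \<forall>x\<in>D. v \<le> F x + \<mu> * g x"
proof -
  define Y where "Y = {y\<in>D. g y < 0}"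
  define \<mu> where "\<mu> = (INF y\<in>Y. (F y - v) / (- g y))"
  have ne: "Y \<noteq> {}" using y0 by (auto simp: Y_def)
  have nonneg: "0 \<le> (F y - v) / (- g y)" if "y \<in> Y" for y
    using that opt[of y] by (intro divide_nonneg_pos) (auto simp: Y_def)
  have bdd: "bdd_below ((\<lambda>y. (F y - v) / (- g y)) ` Y)"
    by (rule bdd_belowI2) (rule nonneg)
  have "0 \<le> \<mu>" unfolding \<mu>_def by (rule cINF_greatest[OF ne nonneg])
  moreover have "v \<le> F x + \<mu> * g x" if x: "x \<in> D" for x
  proof -
    consider "g x < 0" | "g x = 0" | "0 < g x" by linarith
    then show ?thesis
    proof cases
      case 1
      then have "\<mu> \<le> (F x - v) / (- g x)"
        unfolding \<mu>_def using x by (intro cINF_lower[OF bdd]) (auto simp: Y_def)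
      then have "\<mu> * (- g x) \<le> F x - v" using 1 pos_le_divide_eq[of "- g x" \<mu> "F x - v"] by simp
      then show ?thesis by simp
    next
      case 2
      then show ?thesis using opt[OF x] by simp
    next
      case 3
      have "(v - F x) / g x \<le> \<mu>" unfolding \<mu>_def
      proof (rule cINF_greatest[OF ne])
        fix y assume y: "y \<in> Y"
        then have yD: "y \<in> D" and gy: "g y < 0" by (auto simp: Y_def)
        \<comment> \<open>At this \<open>t\<close> the chord of \<open>g\<close> from
          \<open>x\<close> to \<open>y\<close> vanishes, so the intermediate point is feasible and
          \<open>opt\<close> applies to it.\<close>
        define t where "t = g x / (g x - g y)"
        have t: "0 \<le> t" "t \<le> 1" and t1: "(1 - t) * g x + t * g y = 0"
          using 3 gy by (auto simp: t_def field_simps)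
        let ?z = "(1 - t) *\<^sub>R x + t *\<^sub>R y"
        have "?z \<in> D" using convex_on_imp_convex[OF F] x yD t by (auto intro: convexD_alt)
        moreover have "g ?z \<le> 0" using convex_onD[OF g t x yD] t1 by simp
        ultimately have "v \<le> (1 - t) * F x + t * F y"
          using opt[of ?z] convex_onD[OF F t x yD] by linarith
        then have "v * (g x - g y) \<le> ((1 - t) * F x + t * F y) * (g x - g y)"
          using 3 gy by (intro mult_right_mono) auto
        also have "\<dots> = ((1 - t) * (g x - g y)) * F x + (t * (g x - g y)) * F y"
          by (simp add: algebra_simps)
        also have "\<dots> = (- g y) * F x + g x * F y"
        proof -
          have "t * (g x - g y) = g x" using 3 gy by (simp add: t_def)
          then have "(1 - t) * (g x - g y) = - g y" by (simp add: algebra_simps)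
          then show ?thesis using \<open>t * (g x - g y) = g x\<close> by simp
        qed
        finally have "(v - F x) * (- g y) \<le> (F y - v) * g x" by (simp add: algebra_simps)
        then have "v - F x \<le> (F y - v) * g x / (- g y)"
          using gy pos_le_divide_eq[of "- g y" "v - F x" "(F y - v) * g x"] by simp
        then show "(v - F x) / g x \<le> (F y - v) / (- g y)"
          using pos_divide_le_eq[OF 3, of "v - F x" "(F y - v) / (- g y)"] by simp
      qed
      then show ?thesis using 3 by (simp add: field_simps)
    qed
  qed
  ultimately show ?thesis by blast
qed

text \<open>Constraints are removed one at a time: the one-constraint case is applied on the set
  where the remaining constraints hold, and \<open>F + c * g k\<close> then takes the role of the
  objective on all of \<open>D\<close>. This is why the induction leaves \<open>F\<close>
  arbitrary.\<close>

lemma convex_multipliers: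
  fixes F :: "'a::real_vector \<Rightarrow> real" and g :: "'i \<Rightarrow> 'a \<Rightarrow> real"
  assumes "finite K" and "convex_on D F" and "\<And>k. k \<in> K \<Longrightarrow> convex_on D (g k)"
    and "y0 \<in> D" and "\<And>k. k \<in> K \<Longrightarrow> g k y0 < 0"
    and "\<And>x. x \<in> D \<Longrightarrow> (\<forall>k\<in>K. g k x \<le> 0) \<Longrightarrow> v \<le> F x"
  shows "\<exists>\<mu>. (\<forall>k. 0 \<le> \<mu> k) \<and> (\<forall>x\<in>D. v \<le> F x + (\<Sum>k\<in>K. \<mu> k * g k x))"
  using assms
proof (induction K arbitrary: F rule: finite_induct)
  case empty
  then show ?case by (intro exI[of _ "\<lambda>_. 0"]) auto
next
  case (insert k K)
  define D' where "D' = {x\<in>D. \<forall>j\<in>K. g j x \<le> 0}"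
  have convD: "convex D" using insert.prems(1) by (rule convex_on_imp_convex)
  have "convex D'" unfolding convex_alt
  proof (intro ballI allI impI)
    fix x y u assume xy: "x \<in> D'" "y \<in> D'" and u: "0 \<le> u \<and> u \<le> (1::real)"
    have "g j ((1 - u) *\<^sub>R x + u *\<^sub>R y) \<le> 0" if "j \<in> K" for j
    proof -
      have "g j ((1 - u) *\<^sub>R x + u *\<^sub>R y) \<le> (1 - u) * g j x + u * g j y"
        using insert.prems(2)[of j] that xy u by (intro convex_onD) (auto simp: D'_def)
      also have "\<dots> \<le> 0"
        using xy u that by (intro add_nonpos_nonpos mult_nonneg_nonpos) (auto simp: D'_def)
      finally show ?thesis .
    qed
    then show "(1 - u) *\<^sub>R x + u *\<^sub>R y \<in> D'"
      using xy u convD by (auto simp: D'_def convex_alt)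
  qed
  then have sub: "convex_on D' h" if "convex_on D h" for h
    using that by (rule_tac convex_on_subset) (auto simp: D'_def)
  have "\<exists>c\<ge>0. \<forall>x\<in>D'. v \<le> F x + c * g k x"
  proof (rule convex_multiplier)
    show "y0 \<in> D'" using insert.prems by (auto simp: D'_def less_imp_le)
    show "v \<le> F x" if "x \<in> D'" "g k x \<le> 0" for x
      using insert.prems(5)[of x] that by (auto simp: D'_def)
  qed (use insert.prems sub in auto)
  then obtain c where c: "0 \<le> c" "\<And>x. x \<in> D' \<Longrightarrow> v \<le> F x + c * g k x" by blast
  have "\<exists>\<mu>. (\<forall>k. 0 \<le> \<mu> k) \<and> (\<forall>x\<in>D. v \<le> (F x + c * g k x) + (\<Sum>k\<in>K. \<mu> k * g k x))"
    using insert.prems c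
    by (intro insert.IH convex_on_add convex_on_cmul) (auto simp: D'_def)
  then obtain \<mu> where \<mu>: "\<And>k. 0 \<le> \<mu> k"
    "\<And>x. x \<in> D \<Longrightarrow> v \<le> F x + c * g k x + (\<Sum>j\<in>K. \<mu> j * g j x)" by blast
  have "(\<Sum>j\<in>insert k K. (\<mu>(k := c)) j * g j x) = c * g k x + (\<Sum>j\<in>K. \<mu> j * g j x)" for x
  proof -
    have "(\<Sum>j\<in>K. (\<mu>(k := c)) j * g j x) = (\<Sum>j\<in>K. \<mu> j * g j x)"
      using insert.hyps by (intro sum.cong) auto
    then show ?thesis using insert.hyps by simp
  qed
  then show ?case using \<mu> c by (intro exI[of _ "\<mu>(k := c)"]) (auto simp: add.assoc)
qed

text \<open>The coordinates are linearised one at a time, each linear term being absorbed into the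
  coupling function N; this avoids a vector space structure on the product.\<close>

lemma separate_convex_sum:
  fixes g :: "'i \<Rightarrow> 'a::real_normed_vector \<Rightarrow> real" and N :: "('i \<Rightarrow> 'a) \<Rightarrow> real"
  assumes "finite J"
    and "\<And>j. j \<in> J \<Longrightarrow> convex_on (D j) (g j)" and "\<And>j. j \<in> J \<Longrightarrow> xh j \<in> D j"
    and "\<And>x y t. 0 < t \<Longrightarrow> t < 1 \<Longrightarrow>
      N (\<lambda>i. (1 - t) *\<^sub>R x i + t *\<^sub>R y i) \<le> (1 - t) * N x + t * N y"
    and "\<And>j. j \<in> J \<Longrightarrow> \<exists>K. \<forall>x h. N (x(j := x j + h)) \<le> N x + K * norm h"
    and "\<And>x. (\<And>j. j \<in> J \<Longrightarrow> x j \<in> D j) \<Longrightarrow>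
      (\<Sum>j\<in>J. g j (xh j)) + N xh \<le> (\<Sum>j\<in>J. g j (x j)) + N x"
  shows "\<exists>y :: 'i \<Rightarrow> 'a \<Rightarrow>\<^sub>L real.
    (\<forall>j\<in>J. \<forall>z\<in>D j. g j (xh j) + y j (z - xh j) \<le> g j z) \<and>
    (\<forall>x. N xh \<le> (\<Sum>j\<in>J. y j (x j - xh j)) + N x)"
  using assms
proof (induction J arbitrary: N rule: finite_induct)
  case empty
  then show ?case by simp
next
  case (insert k J)
  note gconv = insert.prems(1) and xhD = insert.prems(2) and Nconv = insert.prems(3)
    and NLip = insert.prems(4) and min = insert.prems(5)
  define P where "P = {x. \<forall>j\<in>insert k J. x j \<in> D j}"
  define G where "G x = (\<Sum>j\<in>insert k J. g j (x j) - g j (xh j))" for x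
  \<comment> \<open>The shift \<open>h\<close> detaches the k-th argument of \<open>N\<close> from
    the k-th argument of the functions; at h = 0 the original minimisation problem is
    recovered.\<close>
  define \<Phi> where "\<Phi> x h = G x + N (x(k := x k - h)) - N xh" for x h
  obtain K where K: "\<And>x h. N (x(k := x k + h)) \<le> N x + K * norm h" using NLip[of k] by blast
  have xhP: "xh \<in> P" using xhD by (auto simp: P_def)
  have Gmin: "N xh \<le> G x + N x" if "x \<in> P" for x
  proof -
    have "(\<Sum>j\<in>insert k J. g j (xh j)) + N xh \<le> (\<Sum>j\<in>insert k J. g j (x j)) + N x"
      using that by (intro min) (auto simp: P_def)
    then show ?thesis unfolding G_def sum_subtractf by linarith
  qed
  have Gconv: "G (\<lambda>i. (1 - t) *\<^sub>R x i + t *\<^sub>R y i) \<le> (1 - t) * G x + t * G y"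
    if "x \<in> P" "y \<in> P" "0 < t" "t < 1" for x y t
  proof -
    have "G (\<lambda>i. (1 - t) *\<^sub>R x i + t *\<^sub>R y i) \<le>
      (\<Sum>j\<in>insert k J. (1 - t) * (g j (x j) - g j (xh j)) + t * (g j (y j) - g j (xh j)))"
      unfolding G_def
    proof (rule sum_mono)
      fix j assume j: "j \<in> insert k J"
      have "g j ((1 - t) *\<^sub>R x j + t *\<^sub>R y j) \<le> (1 - t) * g j (x j) + t * g j (y j)"
        using that j by (intro convex_onD[OF gconv]) (auto simp: P_def)
      then show "g j ((1 - t) *\<^sub>R x j + t *\<^sub>R y j) - g j (xh j)
        \<le> (1 - t) * (g j (x j) - g j (xh j)) + t * (g j (y j) - g j (xh j))"
        by (simp add: algebra_simps)
    qed
    then show ?thesis by (simp only: G_def sum.distrib sum_distrib_left)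
  qed
  \<comment> \<open>The Lipschitz bound in coordinate \<open>k\<close> makes the infimum over
    \<open>P\<close> finite for every \<open>h\<close>, so Hahn-Banach applies on the whole space
    although the functions are finite only on their domains.\<close>
  have lower: "- K * norm h \<le> \<Phi> x h" if "x \<in> P" for x h
    using K[of "x(k := x k - h)" h] Gmin[OF that] by (simp add: \<Phi>_def)
  have bdd: "bdd_below ((\<lambda>x. \<Phi> x h) ` P)" for h
    by (rule bdd_belowI2) (rule lower)
  \<comment> \<open>A linear minorant of this infimal convolution is a subgradient of the k-th function (shift only
    coordinate k of the minimiser) and keeps the minimum after linearisation (fix coordinate k).\<close>
  define q where "q h = (INF x\<in>P. \<Phi> x h)" for h
  have "convex_on UNIV q" unfolding q_def
  proof (rule convex_on_INF[OF _ bdd])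
    show "P \<noteq> {}" using xhP by blast
    fix x y :: "'i \<Rightarrow> 'a" and u w :: 'a and t :: real
    assume xy: "x \<in> P" "y \<in> P" and t: "0 < t" "t < 1"
    let ?z = "\<lambda>i. (1 - t) *\<^sub>R x i + t *\<^sub>R y i"
    have "?z \<in> P"
      using xy t gconv[THEN convex_on_imp_convex] by (auto simp: P_def intro!: convexD_alt)
    moreover have "\<Phi> ?z ((1 - t) *\<^sub>R u + t *\<^sub>R w) \<le> (1 - t) * \<Phi> x u + t * \<Phi> y w"
    proof -
      have "?z(k := ?z k - ((1 - t) *\<^sub>R u + t *\<^sub>R w)) =
          (\<lambda>i. (1 - t) *\<^sub>R (x(k := x k - u)) i + t *\<^sub>R (y(k := y k - w)) i)"
        by (auto simp: fun_eq_iff algebra_simps)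
      then have "N (?z(k := ?z k - ((1 - t) *\<^sub>R u + t *\<^sub>R w)))
          \<le> (1 - t) * N (x(k := x k - u)) + t * N (y(k := y k - w))"
        using Nconv[OF t, of "x(k := x k - u)" "y(k := y k - w)"] by (simp only:)
      then show ?thesis using Gconv[OF xy t] by (simp add: \<Phi>_def algebra_simps)
    qed
    ultimately show "\<exists>z\<in>P. \<Phi> z ((1 - t) *\<^sub>R u + t *\<^sub>R w) \<le> (1 - t) * \<Phi> x u + t * \<Phi> y w" by blast
  qed
  moreover have "q 0 = 0"
  proof (rule antisym)
    show "q 0 \<le> 0" unfolding q_def using cINF_lower[OF bdd xhP, of 0] by (simp add: \<Phi>_def G_def)
    show "0 \<le> q 0" unfolding q_def
      using xhP Gmin by (intro cINF_greatest) (auto simp: \<Phi>_def)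
  qed
  ultimately obtain yl where lin: "linear yl" and yl: "\<And>h. yl h \<le> q h"
    using hahn_banach_convex by blast
  have ylP: "yl h \<le> \<Phi> x h" if "x \<in> P" for x h
    using yl[of h] cINF_lower[OF bdd that, of h] by (simp add: q_def)
  \<comment> \<open>The same Lipschitz constant bounds the algebraic linear minorant, which makes it
    continuous.\<close>
  have up: "yl h \<le> K * norm h" for h
    using ylP[OF xhP, of h] K[of xh "- h"] by (simp add: \<Phi>_def G_def)
  have "\<bar>yl h\<bar> \<le> norm h * K" for h
    using up[of h] up[of "- h"] linear_neg[OF lin, of h] by (auto simp: abs_if mult.commute)
  then have "bounded_linear yl"
    using lin unfolding bounded_linear_def bounded_linear_axioms_def by auto
  then obtain yk :: "'a \<Rightarrow>\<^sub>L real" where yk: "blinfun_apply yk = yl"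
    using bounded_linear_Blinfun_apply by blast
  have sub_k: "g k (xh k) + yk (z - xh k) \<le> g k z" if "z \<in> D k" for z
  proof -
    have "xh(k := z) \<in> P" using xhP that by (auto simp: P_def)
    moreover have "\<Phi> (xh(k := z)) (z - xh k) = g k z - g k (xh k)"
    proof -
      have "(\<Sum>j\<in>J. g j ((xh(k := z)) j) - g j (xh j)) = 0"
        using insert.hyps by (intro sum.neutral) auto
      then have "G (xh(k := z)) = g k z - g k (xh k)" unfolding G_def using insert.hyps by simp
      then show ?thesis by (simp add: \<Phi>_def)
    qed
    ultimately show ?thesis using ylP[of "xh(k := z)" "z - xh k"] by (simp add: yk)
  qed
  \<comment> \<open>The added term is affine and depends on coordinate \<open>k\<close> alone, so
    convexity survives and the Lipschitz bounds in the coordinates of \<open>J\<close> are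
    unchanged.\<close>
  define N2 where "N2 x = yk (x k - xh k) + N x" for x
  have "\<exists>y :: 'i \<Rightarrow> 'a \<Rightarrow>\<^sub>L real.
    (\<forall>j\<in>J. \<forall>z\<in>D j. g j (xh j) + y j (z - xh j) \<le> g j z) \<and>
    (\<forall>x. N2 xh \<le> (\<Sum>j\<in>J. y j (x j - xh j)) + N2 x)"
  proof (rule insert.IH)
    show "convex_on (D j) (g j)" "xh j \<in> D j" if "j \<in> J" for j using that gconv xhD by auto
    show "N2 (\<lambda>i. (1 - t) *\<^sub>R x i + t *\<^sub>R y i) \<le> (1 - t) * N2 x + t * N2 y"
      if t: "0 < t" "t < 1" for x y t
    proof -
      have "(1 - t) *\<^sub>R x k + t *\<^sub>R y k - xh k = (1 - t) *\<^sub>R (x k - xh k) + t *\<^sub>R (y k - xh k)"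
        by (simp add: algebra_simps)
      then have "yk ((1 - t) *\<^sub>R x k + t *\<^sub>R y k - xh k)
          = (1 - t) * yk (x k - xh k) + t * yk (y k - xh k)"
        by (simp add: blinfun.add_right blinfun.scaleR_right)
      then show ?thesis using Nconv[OF t, of x y] by (simp add: N2_def algebra_simps)
    qed
    show "\<exists>K. \<forall>x h. N2 (x(j := x j + h)) \<le> N2 x + K * norm h" if jJ: "j \<in> J" for j
    proof -
      have jk: "j \<noteq> k" using jJ insert.hyps by auto
      obtain K' where "\<And>x h. N (x(j := x j + h)) \<le> N x + K' * norm h" using NLip[of j] jJ by blast
      then show ?thesis using jk by (intro exI[of _ K']) (auto simp: N2_def)
    qed
    show "(\<Sum>j\<in>J. g j (xh j)) + N2 xh \<le> (\<Sum>j\<in>J. g j (x j)) + N2 x"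
      if "\<And>j. j \<in> J \<Longrightarrow> x j \<in> D j" for x
    proof -
      have "x(k := xh k) \<in> P" using that xhD by (auto simp: P_def)
      moreover have "\<Phi> (x(k := xh k)) (xh k - x k) = (\<Sum>j\<in>J. g j (x j)) - (\<Sum>j\<in>J. g j (xh j)) + N x - N xh"
      proof -
        have "(\<Sum>j\<in>J. g j ((x(k := xh k)) j) - g j (xh j)) = (\<Sum>j\<in>J. g j (x j) - g j (xh j))"
          using insert.hyps by (intro sum.cong) auto
        then have "G (x(k := xh k)) = (\<Sum>j\<in>J. g j (x j) - g j (xh j))"
          unfolding G_def using insert.hyps by simp
        then show ?thesis by (simp add: \<Phi>_def sum_subtractf)
      qed
      moreover have "yk (xh k - x k) = - yk (x k - xh k)"
        by (simp add: blinfun.diff_right)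
      ultimately show ?thesis using ylP[of "x(k := xh k)" "xh k - x k"]
        by (simp add: yk[symmetric] N2_def blinfun.zero_right)
    qed
  qed
  then obtain y :: "'i \<Rightarrow> 'a \<Rightarrow>\<^sub>L real" where
    y: "\<And>j z. j \<in> J \<Longrightarrow> z \<in> D j \<Longrightarrow> g j (xh j) + y j (z - xh j) \<le> g j z"
       "\<And>x. N2 xh \<le> (\<Sum>j\<in>J. y j (x j - xh j)) + N2 x" by blast
  have "(\<Sum>j\<in>insert k J. (y(k := yk)) j (x j - xh j)) = yk (x k - xh k) + (\<Sum>j\<in>J. y j (x j - xh j))" for x
  proof -
    have "(\<Sum>j\<in>J. (y(k := yk)) j (x j - xh j)) = (\<Sum>j\<in>J. y j (x j - xh j))"
      using insert.hyps by (intro sum.cong) auto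
    then show ?thesis using insert.hyps by simp
  qed
  then show ?case
    using y sub_k by (intro exI[of _ "y(k := yk)"]) (auto simp: N2_def blinfun.zero_right algebra_simps)
qed

section \<open>A fuzzy sum rule for convex functions\<close>

lemma proper_convex_real:
  assumes "proper_convex f" "x \<in> edom f"
  shows "f x = ereal (real_of_ereal (f x))"
  using assms by (cases "f x") (auto simp: proper_convex_def edom_def)

lemma proper_convex_convex_on:
  assumes f: "proper_convex f"
  shows "convex_on (edom f) (\<lambda>x. real_of_ereal (f x))"
proof -
  have *: "f ((1 - t) *\<^sub>R x + t *\<^sub>R y)
      \<le> ereal ((1 - t) * real_of_ereal (f x) + t * real_of_ereal (f y))"
    if "0 < t" "t < 1" "x \<in> edom f" "y \<in> edom f" for t x y
  proof -
    have "f ((1 - t) *\<^sub>R x + t *\<^sub>R y) \<le> ereal (1 - t) * f x + ereal t * f y"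
      using f that by (auto simp: proper_convex_def)
    also have "\<dots> = ereal ((1 - t) * real_of_ereal (f x) + t * real_of_ereal (f y))"
      using proper_convex_real[OF f that(3)] proper_convex_real[OF f that(4)]
      by (metis plus_ereal.simps(1) times_ereal.simps(1))
    finally show ?thesis .
  qed
  have dom: "(1 - t) *\<^sub>R x + t *\<^sub>R y \<in> edom f"
    if "0 < t" "t < 1" "x \<in> edom f" "y \<in> edom f" for t x y
    using *[OF that] by (auto simp: edom_def)
  show ?thesis
  proof (rule convex_onI)
    fix t :: real and x y assume "0 < t" "t < 1" "x \<in> edom f" "y \<in> edom f"
    note t = this
    show "real_of_ereal (f ((1 - t) *\<^sub>R x + t *\<^sub>R y))
      \<le> (1 - t) * real_of_ereal (f x) + t * real_of_ereal (f y)"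
      using *[OF t] proper_convex_real[OF f dom[OF t]] by (metis ereal_less_eq(3))
  next
    show "convex (edom f)" unfolding convex_alt
    proof (intro ballI allI impI)
      fix x y and u :: real assume "x \<in> edom f" "y \<in> edom f" "0 \<le> u \<and> u \<le> 1"
      then show "(1 - u) *\<^sub>R x + u *\<^sub>R y \<in> edom f"
        using dom[of u x y] by (cases "u = 0 \<or> u = 1") auto
    qed
  qed
qed

lemma proper_convexI:
  assumes dom: "edom f \<noteq> {}" "\<And>x. f x \<noteq> -\<infinity>"
    and conv: "convex_on (edom f) (\<lambda>x. real_of_ereal (f x))"
  shows "proper_convex f"
  unfolding proper_convex_def
proof (intro conjI allI ballI)
  show "f x \<noteq> -\<infinity>" for x by (rule dom)
  show "\<exists>x. f x \<noteq> \<infinity>" using dom(1) by (auto simp: edom_def)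
  have real: "f x = ereal (real_of_ereal (f x))" if "x \<in> edom f" for x
    using that dom(2)[of x] by (cases "f x") (auto simp: edom_def)
  fix x y and t :: real assume t: "t \<in> {0<..<1}"
  show "f ((1 - t) *\<^sub>R x + t *\<^sub>R y) \<le> ereal (1 - t) * f x + ereal t * f y"
  proof (cases "x \<in> edom f \<and> y \<in> edom f")
    case True
    let ?z = "(1 - t) *\<^sub>R x + t *\<^sub>R y"
    have z: "?z \<in> edom f"
      using convex_on_imp_convex[OF conv] True t by (intro convexD_alt) auto
    have "real_of_ereal (f ?z) \<le> (1 - t) * real_of_ereal (f x) + t * real_of_ereal (f y)"
      using convex_onD[OF conv, of t x y] True t by simp
    then have "ereal (real_of_ereal (f ?z)) \<le>
        ereal (1 - t) * ereal (real_of_ereal (f x)) + ereal t * ereal (real_of_ereal (f y))" by simp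
    then show ?thesis using real z True by metis
  next
    case False
    then have "f x = \<infinity> \<or> f y = \<infinity>" by (auto simp: edom_def)
    then have "ereal (1 - t) * f x + ereal t * f y = \<infinity>"
      using t dom(2)[of x] dom(2)[of y] by (cases "f x"; cases "f y") auto
    then show ?thesis by (simp only: ereal_less_eq)
  qed
qed

text \<open>For \<open>c = 0\<close> this is the convention that 0 times infinity is infinity: the
  product becomes the indicator function of the domain, which is why a vanishing multiplier later
  yields a normal cone.\<close>

lemma edom_emul:
  assumes "0 \<le> c"
  shows "edom (\<lambda>x. emul c (f x)) = edom f"
proof -
  have "emul c a < \<infinity> \<longleftrightarrow> a < \<infinity>" for a
    using assms by (cases a) (auto simp: emul_def)
  then show ?thesis by (simp add: edom_def)
qed

lemma edom_epos: "edom (\<lambda>x. epos (f x)) = edom f"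
  by (auto simp: edom_def epos_def max_def)

lemma proper_convex_emul:
  assumes f: "proper_convex f" and c: "0 \<le> c"
  shows "proper_convex (\<lambda>x. emul c (f x))"
proof (rule proper_convexI)
  have nm: "f x \<noteq> -\<infinity>" for x using f by (simp add: proper_convex_def)
  note dom = edom_emul[OF c, of f]
  show "edom (\<lambda>x. emul c (f x)) \<noteq> {}"
    using f unfolding dom by (auto simp: proper_convex_def edom_def)
  show "emul c (f x) \<noteq> -\<infinity>" for x
    using nm[of x] by (cases "f x") (auto simp: emul_def)
  have "convex_on (edom f) (\<lambda>x. c * real_of_ereal (f x))"
    using c by (intro convex_on_cmul proper_convex_convex_on f)
  moreover have "real_of_ereal (emul c (f x)) = c * real_of_ereal (f x)" if "x \<in> edom f" for x
    using that by (auto simp: emul_def edom_def)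
  ultimately show "convex_on (edom (\<lambda>x. emul c (f x))) (\<lambda>x. real_of_ereal (emul c (f x)))"
    unfolding dom by (simp add: convex_on_def convex_def)
qed

lemma proper_convex_epos:
  assumes f: "proper_convex f"
  shows "proper_convex (\<lambda>x. epos (f x))"
proof (rule proper_convexI)
  have nm: "f x \<noteq> -\<infinity>" for x using f by (simp add: proper_convex_def)
  note dom = edom_epos[of f]
  show "edom (\<lambda>x. epos (f x)) \<noteq> {}"
    using f unfolding dom by (auto simp: proper_convex_def edom_def)
  show "epos (f x) \<noteq> -\<infinity>" for x
    by (auto simp: epos_def max_def)
  have max: "real_of_ereal (epos (f x)) = max (real_of_ereal (f x)) 0" if "x \<in> edom f" for x
    using that nm[of x] by (cases "f x") (auto simp: epos_def edom_def max_def)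
  have c: "convex_on (edom f) (\<lambda>x. real_of_ereal (f x))" by (rule proper_convex_convex_on[OF f])
  show "convex_on (edom (\<lambda>x. epos (f x))) (\<lambda>x. real_of_ereal (epos (f x)))"
    unfolding dom
  proof (rule convex_onI)
    show "convex (edom f)" using c by (rule convex_on_imp_convex)
    fix t :: real and x y assume t: "0 < t" "t < 1" and xy: "x \<in> edom f" "y \<in> edom f"
    have z: "(1 - t) *\<^sub>R x + t *\<^sub>R y \<in> edom f"
      using convex_on_imp_convex[OF c] xy t by (intro convexD_alt) auto
    have "(1 - t) * real_of_ereal (f x) + t * real_of_ereal (f y)
        \<le> (1 - t) * max (real_of_ereal (f x)) 0 + t * max (real_of_ereal (f y)) 0"
      using t by (intro add_mono mult_left_mono) auto
    moreover have "0 \<le> (1 - t) * max (real_of_ereal (f x)) 0 + t * max (real_of_ereal (f y)) 0"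
      using t by simp
    ultimately show "real_of_ereal (epos (f ((1 - t) *\<^sub>R x + t *\<^sub>R y)))
        \<le> (1 - t) * real_of_ereal (epos (f x)) + t * real_of_ereal (epos (f y))"
      unfolding max[OF z] max[OF xy(1)] max[OF xy(2)]
      using convex_onD[OF c, of t x y] t xy by simp
  qed
qed

section \<open>Lower semicontinuity and local lower bounds\<close>

text \<open>\<open>lsc_at\<close> speaks of punctured neighbourhoods; the point itself satisfies the
  bound by assumption.\<close>

lemma lsc_at_eventually_nhds:
  assumes "lsc_at x f" "y < f x"
  shows "eventually (\<lambda>z. y < f z) (nhds x)"
  using assms unfolding lsc_at_def eventually_at_filter
  by (auto elim: eventually_mono)

text \<open>Used to show that the limit of an Ekeland sequence stays in the domains of the
  functions.\<close>

lemma lsc_at_le: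
  assumes "lsc_at z f" "s \<longlonglongrightarrow> z" "\<And>i. f (s i) \<le> B"
  shows "f z \<le> B"
proof (rule ccontr)
  assume "\<not> ?thesis"
  then have "eventually (\<lambda>z. B < f z) (nhds z)"
    using assms(1) by (intro lsc_at_eventually_nhds) auto
  then have "eventually (\<lambda>i. B < f (s i)) sequentially"
    using eventually_compose_filterlim assms(2) by fast
  then obtain i where "B < f (s i)" using eventually_happens'[OF sequentially_bot] by blast
  then show False using assms(3)[of i] by simp
qed

text \<open>Lower semicontinuity bounds \<open>f\<close> below only near \<open>x0\<close>. For a
  distant \<open>x\<close>, a point of the segment from \<open>x0\<close> to \<open>x\<close> lies
  in that small neighbourhood, and the convexity inequality there can be solved for
  \<open>f x\<close>.\<close>

lemma proper_convex_bounded_below: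
  fixes f :: "'a::real_normed_vector \<Rightarrow> ereal"
  assumes f: "proper_convex f" and x0: "x0 \<in> edom f" and lsc: "lsc_at x0 f" and r: "0 \<le> r"
  shows "\<exists>L. \<forall>x\<in>cball x0 r. ereal (- L) \<le> f x"
proof -
  define a where "a = real_of_ereal (f x0)"
  have a: "f x0 = ereal a" unfolding a_def by (rule proper_convex_real[OF f x0])
  have "eventually (\<lambda>z. ereal (a - 1) < f z) (nhds x0)"
    by (rule lsc_at_eventually_nhds[OF lsc]) (simp add: a)
  then obtain s where s: "0 < s" "\<And>z. dist z x0 < s \<Longrightarrow> ereal (a - 1) < f z"
    unfolding eventually_nhds_metric by blast
  \<comment> \<open>The denominator keeps \<open>t\<close> below 1 and makes \<open>t * r\<close>
    smaller than \<open>s\<close>, so one fraction \<open>t\<close> serves all points of the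
    ball.\<close>
  define t where "t = s / (2 * (s + r))"
  have t: "0 < t" "t < 1" using s(1) r by (auto simp: t_def field_simps)
  have tr: "t * r < s"
  proof -
    have "t * r \<le> t * (s + r)" using t s(1) by (intro mult_left_mono) auto
    also have "\<dots> = s * (s + r) / (2 * (s + r))" by (simp only: t_def times_divide_eq_left)
    also have "\<dots> = s / 2" using s(1) r by (simp del: distrib_left_numeral)
    finally show ?thesis using s(1) by simp
  qed
  have "ereal (- (1 / t - a)) \<le> f x" if x: "x \<in> cball x0 r" for x
  proof (cases "x \<in> edom f")
    case True
    let ?z = "(1 - t) *\<^sub>R x0 + t *\<^sub>R x"
    have "?z - x0 = t *\<^sub>R (x - x0)" by (simp add: algebra_simps)
    then have "dist ?z x0 = t * dist x0 x" using t by (simp add: dist_norm norm_minus_commute)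
    also have "\<dots> \<le> t * r" using t x by simp
    finally have "ereal (a - 1) < f ?z" using tr s(2) by simp
    also have "f ?z \<le> ereal (1 - t) * f x0 + ereal t * f x"
      using f t by (auto simp: proper_convex_def)
    also have "\<dots> = ereal ((1 - t) * a + t * real_of_ereal (f x))"
      using a proper_convex_real[OF f True] by (metis plus_ereal.simps(1) times_ereal.simps(1))
    finally have "a - 1 < (1 - t) * a + t * real_of_ereal (f x)" by simp
    then have "t * (a - 1 / t) \<le> t * real_of_ereal (f x)" using t by (simp add: algebra_simps)
    then have "a - 1 / t \<le> real_of_ereal (f x)" using t by simp
    then show ?thesis using proper_convex_real[OF f True] by (metis ereal_less_eq(3) minus_diff_eq)
  next
    case False
    then show ?thesis by (simp add: edom_def)
  qed
  then show ?thesis by blast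
qed

text \<open>The hypothesis \<open>bound\<close> takes the place of a qualification condition: the
  constant tuple at \<open>xbar\<close> is \<eta>-minimal among tuples in the ball whose entries are
  mutually \<delta>-close. The bound \<alpha> on the sum of the subgradients is the Ekeland slope
  and does not involve \<open>n\<close>.\<close>

lemma fuzzy_sum_rule:
  fixes G :: "nat \<Rightarrow> 'a::banach \<Rightarrow> ereal"
  assumes pc: "\<And>k. k \<le> n \<Longrightarrow> proper_convex (G k)"
    and xbar: "\<And>k. k \<le> n \<Longrightarrow> xbar \<in> edom (G k)"
    and lsc: "\<And>k z. k \<le> n \<Longrightarrow> z \<in> cball xbar r \<Longrightarrow> lsc_at z (G k)"
    and pos: "0 < r" "0 < \<alpha>" "0 < \<delta>" "0 \<le> \<eta>" "\<eta> < \<alpha> * r"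
    and bound: "\<And>x. (\<And>k. k \<le> n \<Longrightarrow> x k \<in> cball xbar r) \<Longrightarrow>
      (\<And>i j. i \<le> n \<Longrightarrow> j \<le> n \<Longrightarrow> dist (x i) (x j) < \<delta>) \<Longrightarrow>
      (\<Sum>k\<le>n. G k xbar) \<le> (\<Sum>k\<le>n. G k (x k)) + ereal \<eta>"
  shows "\<exists>x y. (\<forall>k\<le>n. x k \<in> ball xbar r \<and> x k \<in> edom (G k) \<and> y k \<in> fsubdiff (G k) (x k)) \<and>
    (\<Sum>k\<le>n. G k (x k)) \<le> (\<Sum>k\<le>n. G k xbar) \<and> norm (\<Sum>k\<le>n. y k) \<le> \<alpha>"
proof -
  define g where "g k x = real_of_ereal (G k x)" for k x
  define D where "D k = edom (G k)" for k
  have Gg: "G k x = ereal (g k x)" if "k \<le> n" "x \<in> D k" for k x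
    unfolding g_def using proper_convex_real[OF pc] that by (simp add: D_def)
  have sumG: "(\<Sum>k\<le>n. G k (x k)) = ereal (\<Sum>k\<le>n. g k (x k))" if "\<And>k. k \<le> n \<Longrightarrow> x k \<in> D k" for x
  proof -
    have "(\<Sum>k\<le>n. G k (x k)) = (\<Sum>k\<le>n. ereal (g k (x k)))"
      using that by (intro sum.cong) (auto simp: Gg)
    then show ?thesis by simp
  qed
  have gconv: "convex_on (D k) (g k)" if "k \<le> n" for k
    unfolding D_def g_def[abs_def] by (rule proper_convex_convex_on[OF pc[OF that]])
  have "\<forall>k\<in>{..n}. \<exists>L. \<forall>x\<in>cball xbar r. ereal (- L) \<le> G k x"
    using pc xbar lsc pos by (intro ballI proper_convex_bounded_below) auto
  then obtain L where L: "\<And>k x. k \<le> n \<Longrightarrow> x \<in> cball xbar r \<Longrightarrow> ereal (- L k) \<le> G k x"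
    by (metis atMost_iff)
  have gL: "- L k \<le> g k x" if "k \<le> n" "x \<in> cball xbar r" "x \<in> D k" for k x
    using L[OF that(1,2)] Gg[OF that(1,3)] by simp
  define LL where "LL = (\<Sum>k\<le>n. L k)"
  define v where "v = (\<Sum>k\<le>n. g k xbar)"
  define Z where "Z = {x. \<forall>k\<le>n. x k \<in> cball xbar r \<and> x k \<in> D k}"
  define pen where "pen x = (\<Sum>k\<le>n. norm (x k - x 0))" for x :: "nat \<Rightarrow> 'a"
  \<comment> \<open>A complete metric in which a diagonal translation by h has length only norm h, whatever n is.\<close>
  define d where "d x y = norm (x 0 - y 0) + (\<Sum>k\<le>n. norm ((x k - x 0) - (y k - y 0)))"
    for x y :: "nat \<Rightarrow> 'a"
  \<comment> \<open>Two entries at distance at least \<delta> force \<open>pen\<close> to be at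
    least \<delta>/2, because one of them is that far from entry 0. The penalty of such a tuple is
    then at least \<open>v + LL\<close>, which outweighs the lower bound \<open>- LL\<close> of the
    sum; \<open>max 0\<close> keeps the weight nonnegative.\<close>
  define \<gamma> where "\<gamma> = 2 * max 0 (v + LL) / \<delta>"
  have \<gamma>: "0 \<le> \<gamma>" using pos by (simp add: \<gamma>_def)
  have pen_nonneg: "0 \<le> pen x" for x unfolding pen_def by (intro sum_nonneg) auto
  have pen_ge: "norm (x k - x 0) \<le> pen x" if "k \<le> n" for x k
    unfolding pen_def using that by (intro member_le_sum[of k]) auto
  have d_ge: "norm (x k - y k) \<le> d x y" if "k \<le> n" for x y k
  proof -
    have "x k - y k = (x 0 - y 0) + ((x k - x 0) - (y k - y 0))" by simp
    then have "norm (x k - y k) \<le> norm (x 0 - y 0) + norm ((x k - x 0) - (y k - y 0))"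
      by (metis norm_triangle_ineq)
    also have "norm ((x k - x 0) - (y k - y 0)) \<le> (\<Sum>k\<le>n. norm ((x k - x 0) - (y k - y 0)))"
      using that by (intro member_le_sum[of k]) auto
    finally show ?thesis by (simp add: d_def)
  qed
  define \<phi> where "\<phi> x = (\<Sum>k\<le>n. g k (x k)) + \<gamma> * pen x" for x
  have sum_lower: "- LL \<le> (\<Sum>k\<le>n. g k (x k))" if "x \<in> Z" for x
  proof -
    have "- LL = (\<Sum>k\<le>n. - L k)" by (simp add: LL_def sum_negf)
    also have "\<dots> \<le> (\<Sum>k\<le>n. g k (x k))" using that gL by (intro sum_mono) (auto simp: Z_def)
    finally show ?thesis .
  qed
  have \<phi>_lower: "v - \<eta> \<le> \<phi> x" if x: "x \<in> Z" for x
  proof (cases "\<forall>i\<le>n. \<forall>j\<le>n. dist (x i) (x j) < \<delta>")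
    case True
    have "(\<Sum>k\<le>n. G k xbar) \<le> (\<Sum>k\<le>n. G k (x k)) + ereal \<eta>"
      using x True by (intro bound) (auto simp: Z_def)
    then have "v \<le> (\<Sum>k\<le>n. g k (x k)) + \<eta>"
      using sumG[of "\<lambda>_. xbar"] sumG[of x] x xbar by (simp add: v_def Z_def D_def)
    moreover have "0 \<le> \<gamma> * pen x" using \<gamma> pen_nonneg by simp
    ultimately show ?thesis by (simp add: \<phi>_def)
  next
    case False
    then obtain i j where ij: "i \<le> n" "j \<le> n" "\<delta> \<le> dist (x i) (x j)" by (auto simp: not_less)
    have "dist (x i) (x j) \<le> norm (x i - x 0) + norm (x j - x 0)"
      using dist_triangle2[of "x i" "x j" "x 0"] by (simp add: dist_norm)
    then have "\<delta> / 2 \<le> pen x" using pen_ge[OF ij(1), of x] pen_ge[OF ij(2), of x] ij(3) by linarith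
    then have "\<gamma> * (\<delta> / 2) \<le> \<gamma> * pen x" using \<gamma> by (intro mult_left_mono)
    moreover have "\<gamma> * (\<delta> / 2) = max 0 (v + LL)" using pos by (simp add: \<gamma>_def)
    ultimately show ?thesis using sum_lower[OF x] pos by (simp add: \<phi>_def)
  qed
  have xbZ: "(\<lambda>_. xbar) \<in> Z" using xbar pos by (auto simp: Z_def D_def)
  have "\<exists>z\<in>Z. \<phi> z + \<alpha> * d (\<lambda>_. xbar) z \<le> \<phi> (\<lambda>_. xbar) \<and> (\<forall>w\<in>Z. \<phi> z \<le> \<phi> w + \<alpha> * d z w)"
  proof (rule ekeland_principle[where b = "v - \<eta>"])
    show "d x x = 0" for x by (simp add: d_def)
    show "d x y = d y x" for x y
      unfolding d_def by (simp only: norm_minus_commute[of "x _" "y _"] norm_minus_commute[of "x _ - x 0"])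
    show "d x z \<le> d x y + d y z" for x y z
    proof -
      have "norm ((x k - x 0) - (z k - z 0)) \<le>
          norm ((x k - x 0) - (y k - y 0)) + norm ((y k - y 0) - (z k - z 0))" for k
        using dist_triangle[of "x k - x 0" "z k - z 0" "y k - y 0"] by (simp only: dist_norm)
      then have "(\<Sum>k\<le>n. norm ((x k - x 0) - (z k - z 0))) \<le>
          (\<Sum>k\<le>n. norm ((x k - x 0) - (y k - y 0)) + norm ((y k - y 0) - (z k - z 0)))"
        by (intro sum_mono)
      moreover have "norm (x 0 - z 0) \<le> norm (x 0 - y 0) + norm (y 0 - z 0)"
        using norm_triangle_ineq[of "x 0 - y 0" "y 0 - z 0"] by simp
      ultimately show ?thesis unfolding d_def sum.distrib by linarith
    qed
    fix s :: "nat \<Rightarrow> nat \<Rightarrow> 'a"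
    assume sZ: "range s \<subseteq> Z" and cau: "\<forall>e>0. \<exists>N. \<forall>i\<ge>N. \<forall>j\<ge>N. d (s i) (s j) < e"
      and dec: "decseq (\<lambda>i. \<phi> (s i))"
    have sZ': "s i \<in> Z" for i using sZ by auto
    define z where "z k = lim (\<lambda>i. s i k)" for k
    have lim: "(\<lambda>i. s i k) \<longlonglongrightarrow> z k" if k: "k \<le> n" for k
    proof -
      have "Cauchy (\<lambda>i. s i k)"
      proof (rule CauchyI)
        fix e :: real assume "0 < e"
        then obtain N where "\<forall>i\<ge>N. \<forall>j\<ge>N. d (s i) (s j) < e" using cau by blast
        then show "\<exists>M. \<forall>i\<ge>M. \<forall>j\<ge>M. norm (s i k - s j k) < e"
          using d_ge[OF k] le_less_trans by blast
      qed
      then show ?thesis unfolding z_def by (simp add: Cauchy_convergent_iff convergent_LIMSEQ_iff)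
    qed
    have zc: "z k \<in> cball xbar r" if "k \<le> n" for k
      using sZ' that by (intro closed_sequentially[OF closed_cball _ lim]) (auto simp: Z_def)
    \<comment> \<open>\<phi> decreases along the sequence and the other summands are bounded below,
      so each single summand is bounded above; lower semicontinuity passes this finite bound to the
      limit.\<close>
    have zD: "z k \<in> D k" if k: "k \<le> n" for k
    proof -
      have "G k (s i k) \<le> ereal (\<phi> (s 0) + (LL - L k))" for i
      proof -
        have "(\<Sum>j\<in>{..n} - {k}. - L j) \<le> (\<Sum>j\<in>{..n} - {k}. g j (s i j))"
          using sZ'[of i] gL by (intro sum_mono) (auto simp: Z_def)
        moreover have "(\<Sum>j\<le>n. g j (s i j)) = g k (s i k) + (\<Sum>j\<in>{..n} - {k}. g j (s i j))"
          using k by (intro sum.remove) auto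
        moreover have "LL = L k + (\<Sum>j\<in>{..n} - {k}. L j)"
          unfolding LL_def using k by (intro sum.remove) auto
        moreover have "(\<Sum>j\<le>n. g j (s i j)) \<le> \<phi> (s 0)"
        proof -
          have "0 \<le> \<gamma> * pen (s i)" using \<gamma> pen_nonneg by simp
          then show ?thesis using decseqD[OF dec, of 0 i] by (simp add: \<phi>_def)
        qed
        ultimately have "g k (s i k) \<le> \<phi> (s 0) + (LL - L k)" by (simp add: sum_negf)
        then show ?thesis using Gg[OF k, of "s i k"] sZ'[of i] k by (simp add: Z_def)
      qed
      then have "G k (z k) \<le> ereal (\<phi> (s 0) + (LL - L k))"
        by (intro lsc_at_le[OF lsc[OF k zc[OF k]] lim[OF k]])
      then have "G k (z k) < \<infinity>" by (rule le_less_trans) simp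
      then show ?thesis by (simp add: D_def edom_def)
    qed
    have zZ: "z \<in> Z" using zc zD by (simp add: Z_def)
    have pen_lim: "(\<lambda>i. pen (s i)) \<longlonglongrightarrow> pen z"
      unfolding pen_def by (intro tendsto_intros lim) auto
    have "(\<lambda>i. d (s i) z) \<longlonglongrightarrow> norm (z 0 - z 0) + (\<Sum>k\<le>n. norm ((z k - z 0) - (z k - z 0)))"
      unfolding d_def by (intro tendsto_intros lim) auto
    then have d_lim: "(\<lambda>i. d (s i) z) \<longlonglongrightarrow> 0" by simp
    have "\<phi> z \<le> \<phi> (s j)" for j
    proof (rule field_le_epsilon)
      fix e :: real assume e: "0 < e"
      define e' where "e' = e / real (Suc n)"
      have e': "0 < e'" using e by (simp add: e'_def)
      have "eventually (\<lambda>i. g k (z k) - e' \<le> g k (s i k)) sequentially" if k: "k \<le> n" for k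
      proof -
        have "eventually (\<lambda>x. ereal (g k (z k) - e') < G k x) (nhds (z k))"
          using e' Gg[OF k zD[OF k]] by (intro lsc_at_eventually_nhds lsc[OF k zc[OF k]]) simp
        then have "eventually (\<lambda>i. ereal (g k (z k) - e') < G k (s i k)) sequentially"
          using eventually_compose_filterlim lim[OF k] by fast
        then show ?thesis
        proof (rule eventually_mono)
          fix i assume "ereal (g k (z k) - e') < G k (s i k)"
          then show "g k (z k) - e' \<le> g k (s i k)"
            using Gg[OF k, of "s i k"] sZ'[of i] k by (simp add: Z_def)
        qed
      qed
      then have "eventually (\<lambda>i. \<forall>k\<in>{..n}. g k (z k) - e' \<le> g k (s i k)) sequentially"
        by (intro eventually_ball_finite) auto
      then have "eventually (\<lambda>i. (\<Sum>k\<le>n. g k (z k)) - e + \<gamma> * pen (s i) \<le> \<phi> (s j)) sequentially"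
        using eventually_ge_at_top[of j]
      proof eventually_elim
        case (elim i)
        have "(\<Sum>k\<le>n. g k (z k) - e') \<le> (\<Sum>k\<le>n. g k (s i k))" using elim by (intro sum_mono) auto
        moreover have "(\<Sum>k\<le>n. g k (z k) - e') = (\<Sum>k\<le>n. g k (z k)) - e"
          by (simp add: sum_subtractf e'_def)
        ultimately show ?case using decseqD[OF dec elim(2)] by (simp add: \<phi>_def)
      qed
      moreover have "(\<lambda>i. (\<Sum>k\<le>n. g k (z k)) - e + \<gamma> * pen (s i)) \<longlonglongrightarrow>
          (\<Sum>k\<le>n. g k (z k)) - e + \<gamma> * pen z"
        by (intro tendsto_intros pen_lim)
      ultimately have "(\<Sum>k\<le>n. g k (z k)) - e + \<gamma> * pen z \<le> \<phi> (s j)"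
        by (intro tendsto_upperbound[where F = sequentially]) auto
      then show "\<phi> z \<le> \<phi> (s j) + e" by (simp add: \<phi>_def)
    qed
    then show "\<exists>z\<in>Z. (\<lambda>i. d (s i) z) \<longlonglongrightarrow> 0 \<and> (\<forall>i. \<phi> z \<le> \<phi> (s i))"
      using zZ d_lim by blast
  qed (use \<phi>_lower xbZ pos in auto)
  then obtain xh where xhZ: "xh \<in> Z" and start: "\<phi> xh + \<alpha> * d (\<lambda>_. xbar) xh \<le> \<phi> (\<lambda>_. xbar)"
    and min: "\<And>w. w \<in> Z \<Longrightarrow> \<phi> xh \<le> \<phi> w + \<alpha> * d xh w" by blast
  have \<phi>xb: "\<phi> (\<lambda>_. xbar) = v" by (simp add: \<phi>_def pen_def v_def)
  have "\<alpha> * d (\<lambda>_. xbar) xh < \<alpha> * r" using start \<phi>xb \<phi>_lower[OF xhZ] pos by linarith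
  then have dr: "d (\<lambda>_. xbar) xh < r" using pos by simp
  have xh_ball: "norm (xh k - xbar) \<le> d (\<lambda>_. xbar) xh" if "k \<le> n" for k
    using d_ge[OF that, of "\<lambda>_. xbar" xh] by (simp add: norm_minus_commute)
  have xhD: "xh k \<in> D k" if "k \<le> n" for k using xhZ that by (simp add: Z_def)
  have d_nonneg: "0 \<le> d x y" for x y unfolding d_def by (intro add_nonneg_nonneg sum_nonneg) auto
  \<comment> \<open>Penalty and Ekeland perturbation together form the coupling term: convex, finite
    everywhere, and zero perturbation at \<open>xh\<close>.\<close>
  define N where "N x = \<gamma> * pen x + \<alpha> * d xh x" for x
  have cnorm: "norm ((1 - t) *\<^sub>R a + t *\<^sub>R b) \<le> (1 - t) * norm a + t * norm b"
    if "0 < t" "t < 1" for t and a b :: 'a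
    using norm_triangle_ineq[of "(1 - t) *\<^sub>R a" "t *\<^sub>R b"] that by simp
  have Nconv: "N (\<lambda>i. (1 - t) *\<^sub>R x i + t *\<^sub>R y i) \<le> (1 - t) * N x + t * N y"
    if t: "0 < t" "t < 1" for x y t
  proof -
    let ?w = "\<lambda>i. (1 - t) *\<^sub>R x i + t *\<^sub>R y i"
    have "norm (?w k - ?w 0) \<le> (1 - t) * norm (x k - x 0) + t * norm (y k - y 0)" for k
    proof -
      have "?w k - ?w 0 = (1 - t) *\<^sub>R (x k - x 0) + t *\<^sub>R (y k - y 0)" by (simp add: algebra_simps)
      then show ?thesis using cnorm[OF t] by metis
    qed
    then have "pen ?w \<le> (\<Sum>k\<le>n. (1 - t) * norm (x k - x 0) + t * norm (y k - y 0))"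
      unfolding pen_def by (intro sum_mono)
    then have 1: "pen ?w \<le> (1 - t) * pen x + t * pen y"
      by (simp only: pen_def sum.distrib sum_distrib_left)
    have 2: "norm (xh 0 - ?w 0) \<le> (1 - t) * norm (xh 0 - x 0) + t * norm (xh 0 - y 0)"
    proof -
      have "xh 0 - ?w 0 = (1 - t) *\<^sub>R (xh 0 - x 0) + t *\<^sub>R (xh 0 - y 0)" by (simp add: algebra_simps)
      then show ?thesis using cnorm[OF t] by metis
    qed
    have "norm ((xh k - xh 0) - (?w k - ?w 0)) \<le>
      (1 - t) * norm ((xh k - xh 0) - (x k - x 0)) + t * norm ((xh k - xh 0) - (y k - y 0))" for k
    proof -
      have "(xh k - xh 0) - (?w k - ?w 0) =
          (1 - t) *\<^sub>R ((xh k - xh 0) - (x k - x 0)) + t *\<^sub>R ((xh k - xh 0) - (y k - y 0))"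
        by (simp add: algebra_simps)
      then show ?thesis using cnorm[OF t] by metis
    qed
    then have "(\<Sum>k\<le>n. norm ((xh k - xh 0) - (?w k - ?w 0))) \<le>
      (\<Sum>k\<le>n. (1 - t) * norm ((xh k - xh 0) - (x k - x 0)) + t * norm ((xh k - xh 0) - (y k - y 0)))"
      by (intro sum_mono)
    then have "(\<Sum>k\<le>n. norm ((xh k - xh 0) - (?w k - ?w 0))) \<le>
        (1 - t) * (\<Sum>k\<le>n. norm ((xh k - xh 0) - (x k - x 0)))
        + t * (\<Sum>k\<le>n. norm ((xh k - xh 0) - (y k - y 0)))"
      by (simp only: sum.distrib sum_distrib_left)
    then have "d xh ?w \<le> (1 - t) * d xh x + t * d xh y"
      using 2 unfolding d_def distrib_left by linarith
    then have "\<gamma> * pen ?w + \<alpha> * d xh ?w \<le>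
        \<gamma> * ((1 - t) * pen x + t * pen y) + \<alpha> * ((1 - t) * d xh x + t * d xh y)"
      using 1 \<gamma> pos by (intro add_mono mult_left_mono) auto
    then show ?thesis by (simp add: N_def algebra_simps)
  qed
  \<comment> \<open>Changing coordinate 0 alters all differences to it, hence a constant that grows
    with \<open>n\<close>. The norm bound on the sum of subgradients is obtained separately from
    diagonal shifts and does not inherit it.\<close>
  have NLip: "\<exists>K. \<forall>x h. N (x(j := x j + h)) \<le> N x + K * norm h" for j
  proof (intro exI allI)
    fix x :: "nat \<Rightarrow> 'a" and h :: 'a
    let ?w = "x(j := x j + h)"
    let ?c = "2 * real (Suc n)"
    have pt: "norm (?w k - x k) \<le> norm h" for k by simp
    have diff: "norm ((?w k - ?w 0) - (x k - x 0)) \<le> 2 * norm h" for k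
    proof -
      have eq: "(?w k - ?w 0) - (x k - x 0) = (?w k - x k) - (?w 0 - x 0)" by (simp only: algebra_simps)
      show ?thesis unfolding eq
        using norm_triangle_ineq4[of "?w k - x k" "?w 0 - x 0"] pt[of k] pt[of 0] by linarith
    qed
    have "norm (?w k - ?w 0) \<le> norm (x k - x 0) + 2 * norm h" for k
      using norm_triangle_sub[of "?w k - ?w 0" "x k - x 0"] diff[of k] by linarith
    then have "pen ?w \<le> (\<Sum>k\<le>n. norm (x k - x 0) + 2 * norm h)"
      unfolding pen_def by (intro sum_mono)
    then have 1: "pen ?w \<le> pen x + ?c * norm h" by (simp add: pen_def sum.distrib algebra_simps)
    have "norm ((xh k - xh 0) - (?w k - ?w 0)) \<le> norm ((xh k - xh 0) - (x k - x 0)) + 2 * norm h" for k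
    proof -
      have eq: "(xh k - xh 0) - (?w k - ?w 0) =
          ((xh k - xh 0) - (x k - x 0)) - ((?w k - ?w 0) - (x k - x 0))" by (simp only: algebra_simps)
      show ?thesis unfolding eq
        using norm_triangle_ineq4[of "(xh k - xh 0) - (x k - x 0)" "(?w k - ?w 0) - (x k - x 0)"] diff[of k]
        by linarith
    qed
    then have "(\<Sum>k\<le>n. norm ((xh k - xh 0) - (?w k - ?w 0))) \<le>
        (\<Sum>k\<le>n. norm ((xh k - xh 0) - (x k - x 0)) + 2 * norm h)" by (intro sum_mono)
    moreover have "norm (xh 0 - ?w 0) \<le> norm (xh 0 - x 0) + norm h"
      using norm_triangle_ineq4[of "xh 0 - x 0" "?w 0 - x 0"] pt[of 0] by (simp add: algebra_simps)
    ultimately have 2: "d xh ?w \<le> d xh x + (?c + 1) * norm h"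
      by (simp add: d_def sum.distrib algebra_simps)
    have "N ?w \<le> \<gamma> * (pen x + ?c * norm h) + \<alpha> * (d xh x + (?c + 1) * norm h)"
      unfolding N_def using 1 2 \<gamma> pos by (intro add_mono mult_left_mono) auto
    then show "N ?w \<le> N x + (\<gamma> * ?c + \<alpha> * (?c + 1)) * norm h"
      by (simp add: N_def algebra_simps)
  qed
  have dxx: "d xh xh = 0" by (simp add: d_def)
  \<comment> \<open>Ekeland's principle gives minimality only among tuples in the ball. Since
    \<open>xh\<close> lies at distance less than \<open>r\<close> from the centre, a short step
    towards any admissible \<open>x\<close> stays in the ball, and convexity extends the inequality
    to \<open>x\<close>.\<close>
  have glob: "(\<Sum>k\<le>n. g k (xh k)) + N xh \<le> (\<Sum>k\<le>n. g k (x k)) + N x"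
    if x: "\<And>k. k \<in> {..n} \<Longrightarrow> x k \<in> D k" for x
  proof -
    define R where "R = (\<Sum>k\<le>n. norm (x k - xh k))"
    define e where "e = r - d (\<lambda>_. xbar) xh"
    have e: "0 < e" using dr by (simp add: e_def)
    have R: "0 \<le> R" unfolding R_def by (intro sum_nonneg) auto
    \<comment> \<open>\<open>R + 1\<close> instead of \<open>R\<close> avoids division by zero when
      \<open>x\<close> and \<open>xh\<close> agree in all n + 1 coordinates.\<close>
    define t where "t = min (1/2) (e / (R + 1))"
    have t: "0 < t" "t < 1" using e R by (auto simp: t_def)
    have tR: "t * R \<le> e"
    proof -
      have "t * R \<le> e / (R + 1) * (R + 1)" using e R t by (intro mult_mono) (auto simp: t_def)
      then show ?thesis using R by simp
    qed
    let ?w = "\<lambda>i. (1 - t) *\<^sub>R xh i + t *\<^sub>R x i"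
    have "?w \<in> Z" unfolding Z_def
    proof (intro CollectI allI impI conjI)
      fix k assume k: "k \<le> n"
      show "?w k \<in> D k"
        using convex_on_imp_convex[OF gconv[OF k]] xhD[OF k] x k t by (intro convexD_alt) auto
      have eq: "?w k - xbar = (xh k - xbar) + t *\<^sub>R (x k - xh k)" by (simp add: algebra_simps)
      have "norm (?w k - xbar) \<le> norm (xh k - xbar) + t * norm (x k - xh k)"
        unfolding eq using norm_triangle_ineq[of "xh k - xbar" "t *\<^sub>R (x k - xh k)"] t by simp
      moreover have "t * norm (x k - xh k) \<le> t * R"
        unfolding R_def using k t by (intro mult_left_mono member_le_sum) auto
      ultimately have "norm (?w k - xbar) \<le> r"
        using xh_ball[OF k] tR unfolding e_def by linarith
      then show "?w k \<in> cball xbar r" by (simp add: dist_norm norm_minus_commute)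
    qed
    from min[OF this] have 1: "(\<Sum>k\<le>n. g k (xh k)) + N xh \<le> (\<Sum>k\<le>n. g k (?w k)) + N ?w"
      by (simp add: \<phi>_def N_def dxx)
    have "(\<Sum>k\<le>n. g k (?w k)) \<le> (\<Sum>k\<le>n. (1 - t) * g k (xh k) + t * g k (x k))"
      using t x xhD by (intro sum_mono convex_onD[OF gconv]) auto
    then have "(\<Sum>k\<le>n. g k (?w k)) \<le> (1 - t) * (\<Sum>k\<le>n. g k (xh k)) + t * (\<Sum>k\<le>n. g k (x k))"
      by (simp only: sum.distrib sum_distrib_left)
    then have "t * ((\<Sum>k\<le>n. g k (xh k)) + N xh) \<le> t * ((\<Sum>k\<le>n. g k (x k)) + N x)"
      using 1 Nconv[OF t, of xh x] by (simp add: algebra_simps)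
    then show ?thesis using t by simp
  qed
  have "\<exists>y :: nat \<Rightarrow> 'a \<Rightarrow>\<^sub>L real.
    (\<forall>j\<in>{..n}. \<forall>z\<in>D j. g j (xh j) + y j (z - xh j) \<le> g j z) \<and>
    (\<forall>x. N xh \<le> (\<Sum>j\<in>{..n}. y j (x j - xh j)) + N x)"
    by (rule separate_convex_sum[OF finite_atMost _ _ Nconv NLip glob]) (use gconv xhD in auto)
  then obtain y :: "nat \<Rightarrow> 'a \<Rightarrow>\<^sub>L real" where
    y: "\<And>j z. j \<le> n \<Longrightarrow> z \<in> D j \<Longrightarrow> g j (xh j) + y j (z - xh j) \<le> g j z"
    and yN: "\<And>x. N xh \<le> (\<Sum>j\<le>n. y j (x j - xh j)) + N x" by auto
  have ysub: "y k \<in> fsubdiff (G k) (xh k)" if k: "k \<le> n" for k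
    unfolding fsubdiff_def
  proof (intro CollectI allI)
    fix z
    show "ereal (y k (z - xh k)) \<le> esub (G k z) (G k (xh k))"
    proof (cases "z \<in> D k")
      case True
      then show ?thesis using y[OF k True] Gg[OF k True] Gg[OF k xhD[OF k]] by (simp add: esub_def)
    next
      case False
      then show ?thesis using Gg[OF k xhD[OF k]] by (simp add: esub_def D_def edom_def)
    qed
  qed
  have diag: "- (\<Sum>k\<le>n. y k h) \<le> \<alpha> * norm h" for h
    using yN[of "\<lambda>k. xh k + h"] by (simp add: N_def pen_def d_def)
  have "norm (\<Sum>k\<le>n. y k) \<le> \<alpha>"
  proof (rule norm_blinfun_bound)
    fix h
    show "norm ((\<Sum>k\<le>n. y k) h) \<le> \<alpha> * norm h"
      using diag[of h] diag[of "- h"]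
      by (simp add: blinfun.sum_left blinfun.minus_right sum_negf abs_le_iff)
  qed (use pos in simp)
  moreover have "(\<Sum>k\<le>n. G k (xh k)) \<le> (\<Sum>k\<le>n. G k xbar)"
  proof -
    have "0 \<le> \<gamma> * pen xh" "0 \<le> \<alpha> * d (\<lambda>_. xbar) xh" using \<gamma> pen_nonneg d_nonneg pos by auto
    then have "(\<Sum>k\<le>n. g k (xh k)) \<le> v" using start \<phi>xb by (simp add: \<phi>_def)
    then show ?thesis
      using sumG[of xh] sumG[of "\<lambda>_. xbar"] xhD xbar by (simp add: v_def D_def)
  qed
  moreover have "xh k \<in> ball xbar r" if "k \<le> n" for k
    using xh_ball[OF that] dr by (simp add: dist_norm norm_minus_commute)
  ultimately show ?thesis using ysub xhD unfolding D_def by blast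
qed

section \<open>Duality and the optimality conditions\<close>

lemma sum_ereal_not_MInfty:
  fixes g :: "'i \<Rightarrow> ereal"
  assumes "\<And>k. k \<in> A \<Longrightarrow> g k \<noteq> -\<infinity>"
  shows "sum g A \<noteq> -\<infinity>"
  using assms
proof (induction A rule: infinite_finite_induct)
  case (insert k A)
  then show ?case by (cases "g k"; cases "sum g A") auto
qed auto

lemma emul_not_MInfty: "a \<noteq> -\<infinity> \<Longrightarrow> emul c a \<noteq> -\<infinity>"
  by (cases a) (auto simp: emul_def)

lemma emul_epos_nonneg: "0 \<le> c \<Longrightarrow> 0 \<le> emul c (epos a)"
  by (auto simp: emul_def epos_def)

text \<open>The finite part may be negative but is never minus infinity when the functions are not,
  while the tail is nonnegative for multipliers in the nonnegative cone. Keeping the two apart makes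
  monotone partial sums available and avoids adding infinities of opposite sign.\<close>

definition lagr_head :: "(nat \<Rightarrow> 'a \<Rightarrow> ereal) \<Rightarrow> nat \<Rightarrow> (nat \<Rightarrow> real) \<Rightarrow> 'a \<Rightarrow> ereal" where
  "lagr_head f m l x = f 0 x + (\<Sum>k\<in>{1..m}. emul (l k) (f k x))"

definition lagr_tail :: "(nat \<Rightarrow> 'a \<Rightarrow> ereal) \<Rightarrow> nat \<Rightarrow> (nat \<Rightarrow> real) \<Rightarrow> 'a \<Rightarrow> nat \<Rightarrow> ereal" where
  "lagr_tail f m l x k = (if m < k then emul (l k) (epos (f k x)) else 0)"

lemma lagr_eq: "lagr f m l x = lagr_head f m l x + (\<Sum>k. lagr_tail f m l x k)"
  by (simp add: lagr_def lagr_head_def lagr_tail_def)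

lemma lagr_head_not_MInfty:
  assumes "\<And>k. f k x \<noteq> -\<infinity>"
  shows "lagr_head f m l x \<noteq> -\<infinity>"
proof -
  have "(\<Sum>k\<in>{1..m}. emul (l k) (f k x)) \<noteq> -\<infinity>"
    by (intro sum_ereal_not_MInfty emul_not_MInfty assms)
  then show ?thesis using assms[of 0] unfolding lagr_head_def
    by (cases "f 0 x"; cases "\<Sum>k\<in>{1..m}. emul (l k) (f k x)") auto
qed

lemma lagr_tail_nonneg: "linf_plus l \<Longrightarrow> 0 \<le> lagr_tail f m l x k"
  by (simp add: lagr_tail_def linf_plus_def emul_epos_nonneg)

lemma convex_on_SUP:
  fixes g :: "'i \<Rightarrow> 'a::real_vector \<Rightarrow> real"
  assumes "I \<noteq> {}" and "\<And>i. i \<in> I \<Longrightarrow> convex_on D (g i)" and "convex D"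
    and bdd: "\<And>x. x \<in> D \<Longrightarrow> bdd_above ((\<lambda>i. g i x) ` I)"
  shows "convex_on D (\<lambda>x. SUP i\<in>I. g i x)"
proof (rule convex_onI)
  fix t :: real and x y assume t: "0 < t" "t < 1" and xy: "x \<in> D" "y \<in> D"
  show "(SUP i\<in>I. g i ((1 - t) *\<^sub>R x + t *\<^sub>R y)) \<le> (1 - t) * (SUP i\<in>I. g i x) + t * (SUP i\<in>I. g i y)"
  proof (rule cSUP_least[OF assms(1)])
    fix i assume i: "i \<in> I"
    have "g i ((1 - t) *\<^sub>R x + t *\<^sub>R y) \<le> (1 - t) * g i x + t * g i y"
      using t xy by (intro convex_onD[OF assms(2)[OF i]]) auto
    also have "\<dots> \<le> (1 - t) * (SUP i\<in>I. g i x) + t * (SUP i\<in>I. g i y)"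
      using t i xy by (intro add_mono mult_left_mono cSUP_upper bdd) auto
    finally show "g i ((1 - t) *\<^sub>R x + t *\<^sub>R y) \<le> \<dots>" .
  qed
qed fact

text \<open>The tail constraints enter as the single constraint sup of f k over k > m with one multiplier c; since
  that supremum is at most the sum of the positive parts, a constant tail of multipliers suffices.
  It is taken to be c + 1, so that a finite Lagrangian forces the supremum to be finite.\<close>

lemma slater_strong_duality:
  fixes f :: "nat \<Rightarrow> 'a::real_vector \<Rightarrow> ereal"
  assumes proper: "\<And>k. proper_convex (f k)"
    and slater: "y0 \<in> edom (f 0)" "(SUP k\<in>{1..}. f k y0) < 0"
    and opt: "\<And>x. x \<in> edom (f 0) \<Longrightarrow> (\<And>k. k \<ge> 1 \<Longrightarrow> f k x \<le> 0) \<Longrightarrow> ereal v \<le> f 0 x"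
  shows "\<exists>l. linf_plus l \<and> (\<forall>x. ereal v \<le> lagr f m l x)"
proof -
  define r where "r k x = real_of_ereal (f k x)" for k x
  \<comment> \<open>Boundedness of the tail values is part of the domain, so that their supremum is
    a real-valued convex function on it; this supremum becomes constraint number m + 1.\<close>
  define D where "D = {x. (\<forall>k. x \<in> edom (f k)) \<and> bdd_above ((\<lambda>k. r k x) ` {m<..})}"
  define g where "g k = (if k \<le> m then r k else (\<lambda>x. SUP k\<in>{m<..}. r k x))" for k
  have nm: "f k x \<noteq> -\<infinity>" for k x using proper[of k] by (simp add: proper_convex_def)
  have fr: "f k x = ereal (r k x)" if "x \<in> edom (f k)" for k x
    unfolding r_def by (rule proper_convex_real[OF proper that])
  have rconv: "convex_on (edom (f k)) (r k)" for k
    unfolding r_def[abs_def] by (rule proper_convex_convex_on[OF proper])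
  have convD: "convex D" unfolding convex_alt
  proof (intro ballI allI impI)
    fix x y u assume xy: "x \<in> D" "y \<in> D" and u: "0 \<le> u \<and> u \<le> (1::real)"
    let ?z = "(1 - u) *\<^sub>R x + u *\<^sub>R y"
    have "?z \<in> edom (f k)" for k
      using convex_on_imp_convex[OF rconv] xy u by (intro convexD_alt) (auto simp: D_def)
    moreover have "bdd_above ((\<lambda>k. r k ?z) ` {m<..})"
    proof -
      have "\<exists>b. \<forall>k\<in>{m<..}. r k w \<le> b" if "w \<in> D" for w
        using that unfolding D_def bdd_above_def by auto
      then obtain b c where b: "\<forall>k\<in>{m<..}. r k x \<le> b" and c: "\<forall>k\<in>{m<..}. r k y \<le> c"
        using xy by metis
      show ?thesis
      proof (rule bdd_aboveI2)
        fix k assume k: "k \<in> {m<..}"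
        have "r k ?z \<le> (1 - u) * r k x + u * r k y"
          using xy u by (intro convex_onD[OF rconv]) (auto simp: D_def)
        also have "\<dots> \<le> (1 - u) * b + u * c"
          using u k b c by (intro add_mono mult_left_mono) auto
        finally show "r k ?z \<le> (1 - u) * b + u * c" .
      qed
    qed
    ultimately show "?z \<in> D" by (simp add: D_def)
  qed
  have rconvD: "convex_on D (r k)" for k
    using rconv convD by (rule_tac convex_on_subset[where T = "edom (f k)"]) (auto simp: D_def)
  have gconv: "convex_on D (g k)" for k
    using rconvD convD unfolding g_def
    by (auto intro!: convex_on_SUP simp: D_def)
  \<comment> \<open>A number strictly between the supremum and 0 gives a margin uniform in
    \<open>k\<close>, so the aggregated constraint is also strictly negative at
    \<open>y0\<close>.\<close>
  obtain s where s: "(SUP k\<in>{1..}. f k y0) < s" "s < 0" using slater(2) dense by blast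
  then obtain s' where s': "s = ereal s'" by (cases s) auto
  have fs: "f k y0 \<le> ereal s'" if "1 \<le> k" for k
    using SUP_upper[of k "{1..}" "\<lambda>k. f k y0"] that s s' by (metis atLeast_iff less_imp_le order_trans)
  have y0dom: "y0 \<in> edom (f k)" for k
    using slater(1) fs[of k] by (cases "k = 0") (auto simp: edom_def)
  have rs: "r k y0 \<le> s'" if "1 \<le> k" for k
    using fs[OF that] fr[OF y0dom, of k] by simp
  have s'0: "s' < 0" using s s' by simp
  have y0D: "y0 \<in> D" using y0dom rs by (auto simp: D_def intro!: bdd_aboveI2[of _ _ s'])
  have "\<exists>\<mu>. (\<forall>k. 0 \<le> \<mu> k) \<and> (\<forall>x\<in>D. v \<le> r 0 x + (\<Sum>k\<in>{1..Suc m}. \<mu> k * g k x))"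
  proof (rule convex_multipliers)
    show "g k y0 < 0" if "k \<in> {1..Suc m}" for k
    proof (cases "k \<le> m")
      case True
      then show ?thesis using rs[of k] s'0 that by (simp add: g_def)
    next
      case False
      have "(SUP k\<in>{m<..}. r k y0) \<le> s'" using rs by (intro cSUP_least) auto
      then show ?thesis using False s'0 by (simp add: g_def)
    qed
    show "v \<le> r 0 x" if x: "x \<in> D" and le: "\<forall>k\<in>{1..Suc m}. g k x \<le> 0" for x
    proof -
      have "r k x \<le> 0" if k: "1 \<le> k" for k
      proof (cases "k \<le> m")
        case True
        then show ?thesis using le[rule_format, of k] k by (simp add: g_def)
      next
        case False
        have "r k x \<le> (SUP k\<in>{m<..}. r k x)"
          using False x by (intro cSUP_upper) (auto simp: D_def)
        also have "\<dots> \<le> 0" using le[rule_format, of "Suc m"] by (simp add: g_def)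
        finally show ?thesis .
      qed
      then have "f k x \<le> 0" if "1 \<le> k" for k using fr[of x k] x that by (simp add: D_def)
      then show ?thesis using opt[of x] fr[of x 0] x by (simp add: D_def)
    qed
  qed (use y0D rconvD gconv in auto)
  then obtain \<mu> where \<mu>: "\<And>k. 0 \<le> \<mu> k"
    "\<And>x. x \<in> D \<Longrightarrow> v \<le> r 0 x + (\<Sum>k\<in>{1..Suc m}. \<mu> k * g k x)" by blast
  define c where "c = \<mu> (Suc m)"
  define l where "l k = (if k \<le> m then \<mu> k else c + 1)" for k
  have lp: "linf_plus l" unfolding linf_plus_def
  proof
    show "\<forall>k. 0 \<le> l k" using \<mu>(1) by (simp add: l_def c_def)
    have "range l \<subseteq> \<mu> ` {..m} \<union> {c + 1}" by (auto simp: l_def)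
    then show "bounded (range l)" by (meson bounded_subset finite_imp_bounded finite.intros
        finite_Un finite_imageI finite_atMost)
  qed
  have "ereal v \<le> lagr f m l x" for x
  proof -
    let ?H = "lagr_head f m l x" and ?T = "\<Sum>k. lagr_tail f m l x k"
    have H: "?H \<noteq> -\<infinity>" by (rule lagr_head_not_MInfty) (rule nm)
    have tail: "0 \<le> lagr_tail f m l x k" for k by (rule lagr_tail_nonneg[OF lp])
    have T: "0 \<le> ?T" by (rule suminf_0_le[OF tail])
    show ?thesis
    proof (cases "?H = \<infinity> \<or> ?T = \<infinity>")
      case True
      then have "lagr f m l x = \<infinity>" unfolding lagr_eq using H T by (cases ?H; cases ?T) auto
      then show ?thesis by simp
    next
      case False
      then obtain R where R: "?T = ereal R" using T by (cases ?T) auto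
      \<comment> \<open>If the Lagrangian is infinite there is nothing to prove. Otherwise
        nonnegativity bounds every tail term by the finite sum, which places \<open>x\<close> in all
        the domains and bounds the tail values, so that \<open>x\<close> lies in
        \<open>D\<close>.\<close>
      have term_le: "lagr_tail f m l x k \<le> ereal R" for k
        using sum_le_suminf[of "lagr_tail f m l x" "{k}"] summable_ereal_pos[of "lagr_tail f m l x"] tail R
        by simp
      have tail_dom: "x \<in> edom (f k)" if "m < k" for k
        using term_le[of k] that by (auto simp: lagr_tail_def edom_def emul_def epos_def)
      have head_dom: "x \<in> edom (f k)" if "k \<le> m" for k
      proof (cases "k = 0")
        case True
        then show ?thesis using False by (auto simp: lagr_head_def edom_def)
      next
        case k: False
        have "(\<Sum>k\<in>{1..m}. emul (l k) (f k x)) \<noteq> \<infinity>"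
          using False nm[of 0 x] by (auto simp: lagr_head_def)
        then have "emul (l k) (f k x) \<noteq> \<infinity>" using k that by (auto simp: sum_Pinfty)
        then show ?thesis by (auto simp: edom_def emul_def)
      qed
      have dom: "x \<in> edom (f k)" for k using tail_dom head_dom by (cases "k \<le> m") auto
      have rR: "(c + 1) * max (r k x) 0 \<le> R" if "m < k" for k
        using term_le[of k] that fr[OF dom, of k]
        by (simp add: lagr_tail_def l_def emul_def epos_def flip: zero_ereal_def split: if_splits)
          (auto simp: max_def zero_ereal_def split: if_splits)
      have c: "0 \<le> c" using \<mu>(1) by (simp add: c_def)
      have rR1: "r k x \<le> R" if "m < k" for k
      proof -
        have "1 * max (r k x) 0 \<le> (c + 1) * max (r k x) 0" using c by (intro mult_right_mono) auto
        then show ?thesis using rR[OF that] by simp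
      qed
      have rR2: "c * r k x \<le> R" if "m < k" for k
      proof -
        have "c * r k x \<le> c * max (r k x) 0" using c by (intro mult_left_mono) auto
        also have "\<dots> \<le> (c + 1) * max (r k x) 0" by (intro mult_right_mono) auto
        finally show ?thesis using rR[OF that] by simp
      qed
      have R0: "0 \<le> R" using T R by simp
      have xD: "x \<in> D" using dom rR1 by (auto simp: D_def intro!: bdd_aboveI2[of _ _ R])
      have cR: "c * g (Suc m) x \<le> R"
      proof (cases "c = 0")
        case False
        then have cpos: "0 < c" using c by simp
        have "(SUP k\<in>{m<..}. r k x) \<le> R / c"
          using rR2 cpos by (intro cSUP_least) (auto simp: pos_le_divide_eq mult.commute)
        then show ?thesis using cpos by (simp add: g_def pos_le_divide_eq mult.commute)
      qed (simp add: R0)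
      have "v \<le> r 0 x + (\<Sum>k\<in>{1..m}. l k * r k x) + R"
      proof -
        have "(\<Sum>k\<in>{1..m}. \<mu> k * g k x) = (\<Sum>k\<in>{1..m}. l k * r k x)"
          by (intro sum.cong) (auto simp: l_def g_def)
        then show ?thesis using \<mu>(2)[OF xD] cR by (simp add: c_def)
      qed
      moreover have "?H = ereal (r 0 x + (\<Sum>k\<in>{1..m}. l k * r k x))"
      proof -
        have "(\<Sum>k\<in>{1..m}. emul (l k) (f k x)) = (\<Sum>k\<in>{1..m}. ereal (l k * r k x))"
          using fr[OF dom] by (intro sum.cong) (auto simp: emul_def)
        then show ?thesis using fr[OF dom, of 0] by (simp add: lagr_head_def)
      qed
      ultimately show ?thesis by (simp add: lagr_eq R)
    qed
  qed
  then show ?thesis using lp by blast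
qed

section \<open>From the Lagrangian to the collection of functions\<close>

lemma sum_coll:
  assumes "m \<le> n"
  shows "(\<Sum>k\<le>n. coll f m l k (x k)) = f 0 (x 0) + (\<Sum>k\<in>{1..m}. emul (l k) (f k (x k)))
    + (\<Sum>k\<in>{m+1..n}. emul (l k) (epos (f k (x k))))"
proof -
  have "{..n} = insert 0 ({1..m} \<union> {m+1..n})" using assms by auto
  then have "(\<Sum>k\<le>n. coll f m l k (x k)) = coll f m l 0 (x 0) +
      (\<Sum>k\<in>{1..m} \<union> {m+1..n}. coll f m l k (x k))" by simp
  also have "(\<Sum>k\<in>{1..m} \<union> {m+1..n}. coll f m l k (x k)) =
      (\<Sum>k\<in>{1..m}. coll f m l k (x k)) + (\<Sum>k\<in>{m+1..n}. coll f m l k (x k))"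
    by (intro sum.union_disjoint) auto
  also have "(\<Sum>k\<in>{1..m}. coll f m l k (x k)) = (\<Sum>k\<in>{1..m}. emul (l k) (f k (x k)))"
    by (intro sum.cong) (auto simp: coll_def)
  also have "(\<Sum>k\<in>{m+1..n}. coll f m l k (x k)) = (\<Sum>k\<in>{m+1..n}. emul (l k) (epos (f k (x k))))"
    by (intro sum.cong) (auto simp: coll_def)
  finally show ?thesis by (simp add: coll_def add.assoc)
qed

text \<open>Every finite index set lies in an initial segment, and over long enough segments the
  nonnegative tail dominates any prescribed partial sum. This direction transfers the duality bound
  to the sums that enter uniform lower semicontinuity.\<close>

lemma lagr_le_upper_sum:
  assumes l: "linf_plus l" and nm: "\<And>k. f k x \<noteq> -\<infinity>"
  shows "lagr f m l x \<le> upper_sum (coll f m l) x"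
  unfolding upper_sum_def limsup_fin_def
proof (rule INF_greatest)
  fix S0 :: "nat set" assume "S0 \<in> {S. finite S}"
  then obtain n0 where n0: "S0 \<subseteq> {..n0}" using finite_nat_iff_bounded_le by auto
  let ?B = "SUP S\<in>{S. finite S \<and> S0 \<subseteq> S}. \<Sum>t\<in>S. coll f m l t x"
  have "(\<Sum>k<N. lagr_tail f m l x k) + lagr_head f m l x \<le> ?B" for N
  proof -
    define n where "n = max N (max n0 m)"
    have "(\<Sum>k<N. lagr_tail f m l x k) \<le> (\<Sum>k\<le>n. lagr_tail f m l x k)"
      using lagr_tail_nonneg[OF l] by (intro sum_mono2) (auto simp: n_def)
    also have "\<dots> = (\<Sum>k\<in>{m+1..n}. emul (l k) (epos (f k x)))"
    proof -
      have "(\<Sum>k\<le>n. lagr_tail f m l x k) = (\<Sum>k\<in>{m+1..n}. lagr_tail f m l x k)"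
        by (intro sum.mono_neutral_right) (auto simp: lagr_tail_def)
      also have "\<dots> = (\<Sum>k\<in>{m+1..n}. emul (l k) (epos (f k x)))"
        by (intro sum.cong) (auto simp: lagr_tail_def)
      finally show ?thesis .
    qed
    finally have "(\<Sum>k<N. lagr_tail f m l x k) + lagr_head f m l x \<le>
        (\<Sum>k\<in>{m+1..n}. emul (l k) (epos (f k x))) + lagr_head f m l x"
      by (rule add_right_mono)
    also have "\<dots> = (\<Sum>k\<le>n. coll f m l k x)"
      using sum_coll[of m n f l "\<lambda>_. x"] by (simp add: n_def lagr_head_def add.commute)
    also have "\<dots> \<le> ?B"
      by (rule SUP_upper2[of "{..n}"]) (use n0 in \<open>auto simp: n_def\<close>)
    finally show ?thesis .
  qed
  then have "(\<Sum>k. lagr_tail f m l x k) + lagr_head f m l x \<le> ?B"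
    using lagr_tail_nonneg[OF l] lagr_head_not_MInfty[of f x, OF nm] by (intro suminf_bound_add) auto
  then show "lagr f m l x \<le> ?B" by (simp add: lagr_eq add.commute)
qed

lemma proper_convex_coll:
  assumes "\<And>k. proper_convex (f k)" "linf_plus l"
  shows "proper_convex (coll f m l k)"
proof -
  have "0 \<le> l k" using assms(2) by (simp add: linf_plus_def)
  then have "proper_convex (\<lambda>x. emul (l k) (f k x))" "proper_convex (\<lambda>x. emul (l k) (epos (f k x)))"
    using assms(1) by (auto intro: proper_convex_emul proper_convex_emul[OF proper_convex_epos])
  then show ?thesis using assms(1)[of 0] unfolding coll_def[abs_def] by (cases "k = 0"; cases "k \<le> m") simp_all
qed

text \<open>For positive \<open>c\<close> one divides by \<open>c\<close>. For \<open>c = 0\<close>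
  the scaled function is the indicator of the domain, whose subgradient inequality is the normal
  cone inequality.\<close>

lemma fsubdiff_emul_subset:
  fixes f :: "'a::real_normed_vector \<Rightarrow> ereal"
  assumes f: "proper_convex f" and c: "0 \<le> c" and x: "x \<in> edom f"
  shows "fsubdiff (\<lambda>x. emul c (f x)) x \<subseteq> scaled_subdiff c f x"
proof
  fix y assume "y \<in> fsubdiff (\<lambda>x. emul c (f x)) x"
  then have sub: "ereal (y (z - x)) \<le> esub (emul c (f z)) (emul c (f x))" for z
    by (simp add: fsubdiff_def)
  have real: "f z = ereal (real_of_ereal (f z))" if "z \<in> edom f" for z
    by (rule proper_convex_real[OF f that])
  have le: "y (z - x) \<le> c * (real_of_ereal (f z) - real_of_ereal (f x))" if z: "z \<in> edom f" for z
  proof -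
    obtain a b where "f z = ereal a" "f x = ereal b" using real[OF z] real[OF x] by blast
    then show ?thesis using sub[of z] by (simp add: emul_def esub_def algebra_simps)
  qed
  show "y \<in> scaled_subdiff c f x"
  proof (cases "c = 0")
    case True
    then show ?thesis using le x by (auto simp: scaled_subdiff_def normal_cone_def)
  next
    case False
    then have cpos: "0 < c" using c by simp
    define w where "w = (1 / c) *\<^sub>R y"
    have "w \<in> fsubdiff f x" unfolding fsubdiff_def
    proof (intro CollectI allI)
      fix z
      show "ereal (w (z - x)) \<le> esub (f z) (f x)"
      proof (cases "z \<in> edom f")
        case True
        have "w (z - x) = y (z - x) / c" by (simp add: w_def blinfun.scaleR_left)
        also have "\<dots> \<le> real_of_ereal (f z) - real_of_ereal (f x)"
          using le[OF True] cpos by (simp add: pos_divide_le_eq mult.commute)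
        finally have "w (z - x) \<le> real_of_ereal (f z) - real_of_ereal (f x)" .
        moreover obtain a b where "f z = ereal a" "f x = ereal b" using real[OF True] real[OF x] by blast
        ultimately show ?thesis by (simp add: esub_def)
      next
        case False
        moreover obtain b where "f x = ereal b" using real[OF x] by blast
        ultimately show ?thesis by (simp add: esub_def edom_def)
      qed
    qed
    moreover have "y = c *\<^sub>R w" using cpos by (simp add: w_def)
    ultimately show ?thesis using False by (auto simp: scaled_subdiff_def)
  qed
qed

text \<open>The lower limit over finite sets holds for all sets beyond some \<open>S0\<close>, so it
  may be evaluated at an initial segment as long as desired; a single \<delta> then comes from the
  supremum over \<delta>.\<close>

lemma uniformly_lsc_near_optimal:
  fixes g :: "nat \<Rightarrow> 'a::real_normed_vector \<Rightarrow> ereal"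
  assumes ulsc: "uniformly_lsc U g" and lower: "\<And>x. ereal v \<le> upper_sum g x" and \<eta>: "0 < \<eta>"
  shows "\<exists>n>M. \<exists>\<delta>>0. \<forall>x. (\<forall>k\<le>n. x k \<in> U) \<longrightarrow> (\<forall>i\<le>n. \<forall>j\<le>n. dist (x i) (x j) < \<delta>) \<longrightarrow>
    ereal (v - \<eta>) \<le> (\<Sum>k\<le>n. g k (x k))"
proof -
  define I where "I S \<delta> = (INF xs\<in>{xs. (\<forall>t\<in>S. xs t \<in> U) \<and> diameter (xs ` S) < \<delta>}. \<Sum>t\<in>S. g t (xs t))"
    for S \<delta>
  have "ereal v \<le> (INF x\<in>U. upper_sum g x)" by (intro INF_greatest lower)
  also have "\<dots> \<le> Lambda_U U g" using ulsc by (simp add: uniformly_lsc_def)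
  finally have "ereal (v - \<eta>) < Lambda_U U g" using \<eta> by (auto elim: less_le_trans[rotated])
  then have "ereal (v - \<eta>) < (SUP S0\<in>{S. finite S}. INF S\<in>{S. finite S \<and> S0 \<subseteq> S}. SUP \<delta>\<in>{0<..}. I S \<delta>)"
    by (simp add: Lambda_U_def liminf_fin_def I_def)
  then obtain S0 where S0: "finite S0"
    "ereal (v - \<eta>) < (INF S\<in>{S. finite S \<and> S0 \<subseteq> S}. SUP \<delta>\<in>{0<..}. I S \<delta>)"
    by (auto simp: less_SUP_iff)
  obtain n0 where n0: "S0 \<subseteq> {..n0}" using S0(1) finite_nat_iff_bounded_le by auto
  define n where "n = max n0 (Suc M)"
  have "(INF S\<in>{S. finite S \<and> S0 \<subseteq> S}. SUP \<delta>\<in>{0<..}. I S \<delta>) \<le> (SUP \<delta>\<in>{0<..}. I {..n} \<delta>)"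
    by (rule INF_lower) (use n0 in \<open>auto simp: n_def\<close>)
  then have "ereal (v - \<eta>) < (SUP \<delta>\<in>{0<..}. I {..n} \<delta>)" using S0(2) by (rule less_le_trans[rotated])
  then obtain \<delta> where \<delta>: "0 < \<delta>" "ereal (v - \<eta>) < I {..n} \<delta>" by (auto simp: less_SUP_iff)
  \<comment> \<open>Halving \<delta> turns the bound on pairwise distances into a strict bound on
    the diameter.\<close>
  have "ereal (v - \<eta>) \<le> (\<Sum>k\<le>n. g k (x k))"
    if x: "\<forall>k\<le>n. x k \<in> U" "\<forall>i\<le>n. \<forall>j\<le>n. dist (x i) (x j) < \<delta> / 2" for x
  proof -
    have "diameter (x ` {..n}) \<le> \<delta> / 2"
      using x(2) by (intro diameter_le) (auto simp: dist_norm less_imp_le)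
    then have "I {..n} \<delta> \<le> (\<Sum>k\<le>n. g k (x k))"
      unfolding I_def using x(1) \<delta>(1) by (intro INF_lower) auto
    then show ?thesis using \<delta>(2) by simp
  qed
  moreover have "M < n" by (simp add: n_def)
  ultimately show ?thesis using \<delta>(1) half_gt_zero by blast
qed

section \<open>Optimality conditions at the primal solution\<close>

theorem theorem4p3:
  fixes f :: "nat \<Rightarrow> 'a::banach \<Rightarrow> ereal" and xbar :: 'a
    and m :: nat and l :: "nat \<Rightarrow> real"
  defines "C \<equiv> edom (f 0) \<inter> {x. \<forall>k\<ge>1. f k x \<le> 0}"
  assumes proper: "\<And>k. proper_convex (f k)"
    and C_ne: "C \<noteq> {}"
    and sol: "xbar \<in> C" "\<And>x. x \<in> C \<Longrightarrow> f 0 xbar \<le> f 0 x"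
    and slater: "\<exists>x\<in>edom (f 0). (SUP k\<in>{1..}. f k x) < 0"
    and dual: "dual_solution f m l"
    and lsc: "\<exists>U. open U \<and> xbar \<in> U \<and> (\<forall>k. \<forall>x\<in>U. lsc_at x (coll f m l k))"
    and ulsc: "\<exists>U. xbar \<in> interior U \<and> uniformly_lsc U (coll f m l)"
  shows "(\<forall>k\<in>{1..m}. emul (l k) (f k xbar) = 0) \<and>
    (\<forall>\<epsilon>>0. \<forall>M>m. \<exists>n>M. \<exists>x :: nat \<Rightarrow> 'a.
       (\<forall>k\<le>n. x k \<in> ball xbar \<epsilon>) \<and>
       f 0 (x 0) + (\<Sum>k\<in>{1..m}. emul (l k) (f k (x k)))
         + (\<Sum>k\<in>{m+1..n}. emul (l k) (epos (f k (x k)))) \<le> f 0 xbar \<and>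
       (\<exists>x0' \<in> fsubdiff (f 0) (x 0). \<exists>y :: nat \<Rightarrow> ('a \<Rightarrow>\<^sub>L real).
          (\<forall>k\<in>{1..m}. y k \<in> scaled_subdiff (l k) (f k) (x k)) \<and>
          (\<forall>k\<in>{m+1..n}. y k \<in> scaled_subdiff (l k) (\<lambda>z. epos (f k z)) (x k)) \<and>
          norm (x0' + (\<Sum>k\<in>{1..n}. y k)) < \<epsilon>))"
proof -
  let ?G = "coll f m l"
  have l: "linf_plus l" and lmax: "\<And>l'. linf_plus l' \<Longrightarrow> (INF x. lagr f m l' x) \<le> (INF x. lagr f m l x)"
    using dual by (auto simp: dual_solution_def)
  have l0: "0 \<le> l k" for k using l by (simp add: linf_plus_def)
  have nm: "f k x \<noteq> -\<infinity>" for k x using proper[of k] by (simp add: proper_convex_def)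
  have xdom: "xbar \<in> edom (f 0)" and xle: "\<And>k. 1 \<le> k \<Longrightarrow> f k xbar \<le> 0"
    using sol(1) by (auto simp: C_def)
  define v where "v = real_of_ereal (f 0 xbar)"
  have v: "f 0 xbar = ereal v" unfolding v_def by (rule proper_convex_real[OF proper xdom])
  obtain y0 where "y0 \<in> edom (f 0)" "(SUP k\<in>{1..}. f k y0) < 0" using slater by blast
  then obtain l' where l': "linf_plus l'" "\<And>x. ereal v \<le> lagr f m l' x"
    using slater_strong_duality[of f y0 v m] proper sol(2) v by (auto simp: C_def)
  have "ereal v \<le> (INF x. lagr f m l' x)" by (intro INF_greatest l'(2))
  also have "\<dots> \<le> (INF x. lagr f m l x)" by (rule lmax[OF l'(1)])
  finally have lagr_ge: "ereal v \<le> lagr f m l x" for x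
    by (rule order_trans) (simp add: INF_lower)
  have head_le: "emul (l k) (f k xbar) \<le> 0" if "k \<in> {1..m}" for k
  proof -
    have "f k xbar \<le> 0" using xle that by simp
    then show ?thesis using l0[of k] by (cases "f k xbar") (auto simp: emul_def mult_nonneg_nonpos)
  qed
  have tail0: "emul (l k) (epos (f k xbar)) = 0" if "m < k" for k
    using xle[of k] that by (auto simp: emul_def epos_def max_def)
  have head0: "emul (l k) (f k xbar) = 0" if k: "k \<in> {1..m}" for k
  proof (rule antisym[OF head_le[OF k]])
    have "(\<lambda>k. if m < k then emul (l k) (epos (f k xbar)) else 0) = (\<lambda>_. 0)"
      using tail0 by auto
    then have "lagr f m l xbar = ereal v + (\<Sum>k\<in>{1..m}. emul (l k) (f k xbar))"
      unfolding lagr_def v by simp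
    then have "0 \<le> (\<Sum>k\<in>{1..m}. emul (l k) (f k xbar))"
      using lagr_ge[of xbar] by (cases "\<Sum>k\<in>{1..m}. emul (l k) (f k xbar)") auto
    \<comment> \<open>All terms are nonpositive while their sum is nonnegative, so isolating one
      term shows that it vanishes.\<close>
    also have "\<dots> = emul (l k) (f k xbar) + (\<Sum>j\<in>{1..m} - {k}. emul (l j) (f j xbar))"
      using k by (intro sum.remove) auto
    also have "\<dots> \<le> emul (l k) (f k xbar) + 0"
      by (intro add_left_mono sum_nonpos head_le) auto
    finally show "0 \<le> emul (l k) (f k xbar)" by simp
  qed
  \<comment> \<open>Hence every partial sum at \<open>xbar\<close> containing index 0 equals
    \<open>v\<close>, so the bound on the infinite Lagrangian can be compared with finite sums
    without a remainder.\<close>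
  have Gbar: "?G k xbar = (if k = 0 then ereal v else 0)" for k
    using head0[of k] tail0[of k] v by (auto simp: coll_def)
  have pcG: "proper_convex (?G k)" for k by (rule proper_convex_coll[OF proper l])
  have upper: "ereal v \<le> upper_sum ?G x" for x
    using lagr_ge[of x] lagr_le_upper_sum[of l f x m, OF l nm] by (rule order_trans)
  obtain V where V: "open V" "xbar \<in> V" "\<And>k x. x \<in> V \<Longrightarrow> lsc_at x (?G k)" using lsc by blast
  obtain U where U: "xbar \<in> interior U" "uniformly_lsc U ?G" using ulsc by blast
  have "\<exists>n>M. \<exists>x :: nat \<Rightarrow> 'a.
       (\<forall>k\<le>n. x k \<in> ball xbar \<epsilon>) \<and>
       f 0 (x 0) + (\<Sum>k\<in>{1..m}. emul (l k) (f k (x k)))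
         + (\<Sum>k\<in>{m+1..n}. emul (l k) (epos (f k (x k)))) \<le> f 0 xbar \<and>
       (\<exists>x0' \<in> fsubdiff (f 0) (x 0). \<exists>y :: nat \<Rightarrow> ('a \<Rightarrow>\<^sub>L real).
          (\<forall>k\<in>{1..m}. y k \<in> scaled_subdiff (l k) (f k) (x k)) \<and>
          (\<forall>k\<in>{m+1..n}. y k \<in> scaled_subdiff (l k) (\<lambda>z. epos (f k z)) (x k)) \<and>
          norm (x0' + (\<Sum>k\<in>{1..n}. y k)) < \<epsilon>)"
    if \<epsilon>: "0 < \<epsilon>" and M: "m < M" for \<epsilon> M
  proof -
    have "open (interior U \<inter> V \<inter> ball xbar \<epsilon>)" "xbar \<in> interior U \<inter> V \<inter> ball xbar \<epsilon>"
      using U V \<epsilon> by auto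
    then obtain r where r: "0 < r" "cball xbar r \<subseteq> interior U \<inter> V \<inter> ball xbar \<epsilon>"
      using open_contains_cball by blast
    \<comment> \<open>The half in \<alpha> makes the final norm bound strict, and the half in \<eta>
      gives the strict inequality that the fuzzy sum rule asks for.\<close>
    define \<alpha> where "\<alpha> = \<epsilon> / 2"
    define \<eta> where "\<eta> = \<alpha> * r / 2"
    have pos: "0 < \<alpha>" "0 < \<eta>" "\<eta> < \<alpha> * r" using \<epsilon> r by (auto simp: \<alpha>_def \<eta>_def)
    obtain n \<delta> where n: "M < n" and \<delta>: "0 < \<delta>" and
      near: "\<And>x. (\<forall>k\<le>n. x k \<in> U) \<Longrightarrow> (\<forall>i\<le>n. \<forall>j\<le>n. dist (x i) (x j) < \<delta>) \<Longrightarrow>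
        ereal (v - \<eta>) \<le> (\<Sum>k\<le>n. ?G k (x k))"
      using uniformly_lsc_near_optimal[OF U(2) upper pos(2), of M] by blast
    have sumbar: "(\<Sum>k\<le>n. ?G k xbar) = ereal v"
      by (simp add: Gbar)
    have "\<exists>x y. (\<forall>k\<le>n. x k \<in> ball xbar r \<and> x k \<in> edom (?G k) \<and> y k \<in> fsubdiff (?G k) (x k)) \<and>
      (\<Sum>k\<le>n. ?G k (x k)) \<le> (\<Sum>k\<le>n. ?G k xbar) \<and> norm (\<Sum>k\<le>n. y k) \<le> \<alpha>"
    proof (rule fuzzy_sum_rule[OF pcG])
      show "xbar \<in> edom (?G k)" for k by (simp add: edom_def Gbar)
      show "lsc_at z (?G k)" if "z \<in> cball xbar r" for k z using V(3) r(2) that by blast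
      show "(\<Sum>k\<le>n. ?G k xbar) \<le> (\<Sum>k\<le>n. ?G k (x k)) + ereal \<eta>"
        if x: "\<And>k. k \<le> n \<Longrightarrow> x k \<in> cball xbar r"
          "\<And>i j. i \<le> n \<Longrightarrow> j \<le> n \<Longrightarrow> dist (x i) (x j) < \<delta>" for x
      proof -
        have "\<forall>k\<le>n. x k \<in> U" using x(1) r(2) interior_subset by blast
        then have "ereal (v - \<eta>) \<le> (\<Sum>k\<le>n. ?G k (x k))" using x(2) by (intro near) auto
        then have "ereal (v - \<eta>) + ereal \<eta> \<le> (\<Sum>k\<le>n. ?G k (x k)) + ereal \<eta>" by (rule add_right_mono)
        then show ?thesis by (simp add: sumbar)
      qed
    qed (use r pos \<delta> in auto)
    then obtain x y where x: "\<And>k. k \<le> n \<Longrightarrow> x k \<in> ball xbar r" "\<And>k. k \<le> n \<Longrightarrow> x k \<in> edom (?G k)"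
      and y: "\<And>k. k \<le> n \<Longrightarrow> y k \<in> fsubdiff (?G k) (x k)"
      and le: "(\<Sum>k\<le>n. ?G k (x k)) \<le> (\<Sum>k\<le>n. ?G k xbar)" and ny: "norm (\<Sum>k\<le>n. y k) \<le> \<alpha>" by blast
    have mn: "m \<le> n" using M n by simp
    have "x k \<in> ball xbar \<epsilon>" if "k \<le> n" for k
      using x(1)[OF that] r(2) ball_subset_cball by blast
    moreover have "f 0 (x 0) + (\<Sum>k\<in>{1..m}. emul (l k) (f k (x k)))
         + (\<Sum>k\<in>{m+1..n}. emul (l k) (epos (f k (x k)))) \<le> f 0 xbar"
      using le unfolding sumbar sum_coll[OF mn] v .
    moreover have "y 0 \<in> fsubdiff (f 0) (x 0)"
    proof -
      have "?G 0 = f 0" by (simp add: coll_def fun_eq_iff)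
      then show ?thesis using y[of 0] by simp
    qed
    moreover have "y k \<in> scaled_subdiff (l k) (f k) (x k)" if k: "k \<in> {1..m}" for k
    proof -
      have G: "?G k = (\<lambda>z. emul (l k) (f k z))" using k by (auto simp: coll_def fun_eq_iff)
      have "x k \<in> edom (f k)" using x(2)[of k] k mn by (simp add: G edom_emul[OF l0])
      then show ?thesis
        using fsubdiff_emul_subset[OF proper l0] y[of k] k mn G by fastforce
    qed
    moreover have "y k \<in> scaled_subdiff (l k) (\<lambda>z. epos (f k z)) (x k)" if k: "k \<in> {m+1..n}" for k
    proof -
      have G: "?G k = (\<lambda>z. emul (l k) (epos (f k z)))" using k by (auto simp: coll_def fun_eq_iff)
      have "x k \<in> edom (\<lambda>z. epos (f k z))" using x(2)[of k] k by (simp add: G edom_emul[OF l0])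
      then show ?thesis
        using fsubdiff_emul_subset[OF proper_convex_epos[OF proper] l0] y[of k] k G by fastforce
    qed
    moreover have "norm (y 0 + (\<Sum>k\<in>{1..n}. y k)) < \<epsilon>"
    proof -
      have "{..n} = insert 0 {1..n}" by auto
      then have "(\<Sum>k\<le>n. y k) = y 0 + (\<Sum>k\<in>{1..n}. y k)" by simp
      then show ?thesis using ny \<epsilon> by (simp add: \<alpha>_def)
    qed
    ultimately show ?thesis using n by blast
  qed
  then show ?thesis using head0 by blast
qed

end
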